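(* Let $T\ge 1$, $n\ge 2$, $d\ge 1$, $\boldsymbol\mu\in\mathbb{R}^d$, let $\boldsymbol\Sigma\in\mathbb{R}^{d\times d}$ be positive definite, let $\mathbf{z}^*\in\mathbb{R}^d$ and $\tau\in\{1,\dots,T\}$ be fixed. Data consist of $T$ batches $D_1,\dots,D_T$, batch $D_t$ consisting of $n$ points $\mathbf{X}_{t,1},\dots,\mathbf{X}_{t,n}\in\mathbb{R}^d$. Under the hypothesis $\mathbf{H_0}$ all $nT$ points are i.i.d. $\mathcal{N}(\boldsymbol\mu,\boldsymbol\Sigma)$. Under the hypothesis $\mathbf{H_1^\tau}$ the points are generated in the same way and then the $J$-th point of $D_\tau$ is replaced by $\mathbf{z}^*$, where $J$ is uniform on $\{1,\dots,n\}$ and independent of the data. The observations are the cumulative empirical means $\hat{\boldsymbol\mu}_t=\frac{1}{nt}\sum_{j=1}^t\sum_{k=1}^n\mathbf{X}_{j,k}$, $t=1,\dots,T$. Let $\bar{\mathbf{X}}_\tau=\frac1n\sum_{k=1}^n\mathbf{X}_{\tau,k}=\tau\hat{\boldsymbol\mu}_\tau-(\tau-1)\hat{\boldsymbol\mu}_{\tau-1}$ (with $\hat{\boldsymbol\mu}_0:=0$) and $\mathbf{N_\tau}=\bar{\mathbf{X}}_\tau-\boldsymbol\mu$. Then the logarithm $\log\mathrm{LR}_\tau$ of the ratio of the joint density of $(\hat{\boldsymbol\mu}_1,\dots,\hat{\boldsymbol\mu}_T)$ under $\mathbf{H_1^\tau}$ to its joint density under $\mathbf{H_0}$ satisfies \[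 \log\mathrm{LR}_\tau=-\frac d2\log\Big(\frac{n-1}{n}\Big)-\frac{n}{2(n-1)}\mathbf{N_\tau}^\top\boldsymbol\Sigma^{-1}\mathbf{N_\tau}+\frac{n}{n-1}\mathbf{N_\tau}^\top\boldsymbol\Sigma^{-1}(\mathbf{z}^*-\boldsymbol\mu)-\frac{m^*}{2(n-1)}, \] where $m^*=(\mathbf{z}^*-\boldsymbol\mu)^\top\boldsymbol\Sigma^{-1}(\mathbf{z}^*-\boldsymbol\mu)$.
   Context: This is the likelihood ratio for a membership inference test that observes the whole sequence of empirical means and knows the insertion time $\tau$ of the target $\mathbf{z}^*$. *)

theory Defs
  imports "HOL-Analysis.Analysis" "HOL-Probability.Probability"
begin

definition pos_def_mat :: "real^'d^'d \<Rightarrow> bool" where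
  "pos_def_mat S \<longleftrightarrow> transpose S = S \<and> (\<forall>x. x \<noteq> 0 \<longrightarrow> x \<bullet> (S *v x) > 0)"

definition gauss_density :: "real^'d \<Rightarrow> real^'d^'d \<Rightarrow> real^'d \<Rightarrow> real" where
  "gauss_density mu S x =
     exp (- ((x - mu) \<bullet> (matrix_inv S *v (x - mu))) / 2)
     / sqrt ((2 * pi) ^ CARD('d) * det S)"

definition gauss_measure :: "real^'d \<Rightarrow> real^'d^'d \<Rightarrow> (real^'d) measure" where
  "gauss_measure mu S = density lborel (\<lambda>x. ennreal (gauss_density mu S x))"

text \<open>Data: points X(t,k), t in 1..T (batch), k in 1..n (index within the batch).
  Under H0 all n*T points are i.i.d. N(mu, S).\<close>
definition H0_data :: "nat \<Rightarrow> nat \<Rightarrow> real^'d \<Rightarrow> real^'d^'d \<Rightarrow> (nat \<times> nat \<Rightarrow> real^'d) measure" where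
  "H0_data T n mu S = PiM ({1..T} \<times> {1..n}) (\<lambda>_. gauss_measure mu S)"

definition H1_data :: "nat \<Rightarrow> nat \<Rightarrow> nat \<Rightarrow> real^'d \<Rightarrow> real^'d^'d \<Rightarrow> real^'d
    \<Rightarrow> (nat \<times> nat \<Rightarrow> real^'d) measure" where
  "H1_data T n tau mu S z =
     measure_pmf (pmf_of_set {1..n}) \<bind>
       (\<lambda>J. distr (H0_data T n mu S) (H0_data T n mu S) (\<lambda>X. X((tau, J) := z)))"

definition obs_space :: "nat \<Rightarrow> (nat \<Rightarrow> real^'d) measure" where
  "obs_space T = PiM {1..T} (\<lambda>_. lborel)"

definition cum_means :: "nat \<Rightarrow> nat \<Rightarrow> (nat \<times> nat \<Rightarrow> real^'d) \<Rightarrow> (nat \<Rightarrow> real^'d)" where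
  "cum_means T n X = (\<lambda>t\<in>{1..T}. (1 / (real n * real t)) *\<^sub>R (\<Sum>j=1..t. \<Sum>k=1..n. X (j, k)))"

definition mu_hat :: "(nat \<Rightarrow> real^'d) \<Rightarrow> nat \<Rightarrow> real^'d" where
  "mu_hat y t = (if t = 0 then 0 else y t)"

text \<open>N_tau = bar X_tau - mu, where bar X_tau = tau hat mu_tau - (tau-1) hat mu_{tau-1}.\<close>
definition N_tau :: "nat \<Rightarrow> real^'d \<Rightarrow> (nat \<Rightarrow> real^'d) \<Rightarrow> real^'d" where
  "N_tau tau mu y = (real tau *\<^sub>R mu_hat y tau - (real tau - 1) *\<^sub>R mu_hat y (tau - 1)) - mu"

end

theory Submission
  imports Defs
begin

text \<open>
  Write \<open>W\<^sub>t\<close> for the mean of batch \<open>t\<close>. Under both hypotheses the \<open>W\<^sub>t\<close> are independent, and all of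
  them are \<open>N(\<mu>, \<Sigma>/n)\<close>, except that under the alternative \<open>W\<^sub>\<tau>\<close> is
  \<open>N((z + (n - 1) \<mu>)/n, (n - 1)/n\<^sup>2 \<Sigma>)\<close>, whatever the replaced index is. So the law of \<open>W\<close> under the
  alternative has a density \<open>r(W\<^sub>\<tau>)\<close> with respect to its law under the null hypothesis, where \<open>r\<close>
  is a ratio of two normal densities. The cumulative means are an injective function of \<open>W\<close> from
  which \<open>W\<^sub>\<tau>\<close> is recovered as \<open>\<tau> y\<^sub>\<tau> - (\<tau> - 1) y\<^sub>\<tau>\<^sub>-\<^sub>1\<close>, hence their laws have the density ratio
  \<open>r(\<tau> y\<^sub>\<tau> - (\<tau> - 1) y\<^sub>\<tau>\<^sub>-\<^sub>1)\<close>, and no Jacobian is needed. The inverse of this function also preserves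
  null sets, so the density under the null hypothesis is almost everywhere nonzero.
\<close>

section \<open>Affine changes of variables for Lebesgue measure\<close>

lemma nn_integral_lborel_split_coordinate:
  fixes b :: "'a::euclidean_space" and f :: "'a \<Rightarrow> ennreal"
  assumes b: "b \<in> Basis" and [measurable]: "f \<in> borel_measurable borel"
  shows "(\<integral>\<^sup>+x. f x \<partial>lborel) =
    (\<integral>\<^sup>+X. \<integral>\<^sup>+t. f ((\<Sum>c\<in>Basis - {b}. X c *\<^sub>R c) + t *\<^sub>R b) \<partial>lborel \<partial>PiM (Basis - {b}) (\<lambda>_. lborel))"
proof -
  interpret product_sigma_finite "\<lambda>_::'a. lborel :: real measure" ..
  let ?g = "\<lambda>X. f (\<Sum>c\<in>Basis. X c *\<^sub>R c)"
  have Basis: "Basis = insert b (Basis - {b})" using b by blast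
  have "(\<integral>\<^sup>+x. f x \<partial>lborel) = (\<integral>\<^sup>+X. ?g X \<partial>PiM Basis (\<lambda>_. lborel))"
    by (subst lborel_def) (simp add: nn_integral_distr flip: lborel_eq_real)
  also have "\<dots> = (\<integral>\<^sup>+X. \<integral>\<^sup>+t. ?g (X(b := t)) \<partial>lborel \<partial>PiM (Basis - {b}) (\<lambda>_. lborel))"
    using product_nn_integral_insert[of "Basis - {b}" b ?g] unfolding Basis[symmetric] by simp
  finally show ?thesis
    using b by (simp add: sum.remove[OF _ b] add.commute)
qed

lemma distr_lborel_shear:
  fixes b :: "'a::euclidean_space" and \<phi> :: "'a \<Rightarrow> real"
  assumes b: "b \<in> Basis" and [measurable]: "\<phi> \<in> borel_measurable borel"
    and \<phi>: "\<And>x c. \<phi> (x + c *\<^sub>R b) = \<phi> x"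
  shows "distr lborel borel (\<lambda>x. x + \<phi> x *\<^sub>R b) = lborel"
proof (rule measure_eqI)
  fix A :: "'a set" assume "A \<in> sets (distr lborel borel (\<lambda>x. x + \<phi> x *\<^sub>R b))"
  then have [measurable]: "A \<in> sets borel" by simp
  let ?P = "PiM (Basis - {b}) (\<lambda>_. lborel :: real measure)" and ?x = "\<lambda>X. \<Sum>c\<in>Basis - {b}. X c *\<^sub>R c"
  have translate: "(\<integral>\<^sup>+t. indicator A (x + (t + s) *\<^sub>R b) \<partial>lborel)
      = (\<integral>\<^sup>+t. indicator A (x + t *\<^sub>R b) \<partial>lborel)"
    for x s
    by (subst (2) nn_integral_real_affine[of _ 1 s]) (simp_all add: add.commute)
  have "emeasure (distr lborel borel (\<lambda>x. x + \<phi> x *\<^sub>R b)) A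
      = (\<integral>\<^sup>+x. indicator A (x + \<phi> x *\<^sub>R b) \<partial>lborel)"
    by (simp add: nn_integral_distr flip: nn_integral_indicator)
  also have "\<dots> = (\<integral>\<^sup>+X. \<integral>\<^sup>+t. indicator A (?x X + (t + \<phi> (?x X)) *\<^sub>R b) \<partial>lborel \<partial>?P)"
    by (subst nn_integral_lborel_split_coordinate[OF b]) (simp_all add: \<phi> scaleR_add_left add.assoc)
  also have "\<dots> = (\<integral>\<^sup>+x. indicator A x \<partial>lborel)"
    by (subst nn_integral_lborel_split_coordinate[OF b]) (simp_all add: translate)
  finally show "emeasure (distr lborel borel (\<lambda>x. x + \<phi> x *\<^sub>R b)) A = emeasure lborel A"
    by simp
qed simp

lemma prod_Basis_vec: "(\<Prod>b\<in>(Basis::(real^'n) set). g b) = (\<Prod>i\<in>UNIV. g (axis i (1::real)))"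
proof -
  have "bij_betw (\<lambda>i::'n. axis i (1::real)) UNIV Basis"
    by (auto simp: bij_betw_def inj_on_def axis_eq_axis Basis_vec_def)
  from prod.reindex_bij_betw[OF this, of g] show ?thesis by simp
qed

lemma emeasure_lborel_box_vec:
  fixes l u :: "real^'n"
  assumes "\<And>i. l $ i \<le> u $ i"
  shows "emeasure lborel (box l u) = (\<Prod>i\<in>UNIV. u $ i - l $ i)"
proof -
  have "l \<bullet> b \<le> u \<bullet> b" if "b \<in> Basis" for b
    using that assms by (auto simp: Basis_vec_def inner_axis)
  then show ?thesis by (simp add: prod_Basis_vec inner_axis)
qed

lemma distr_lborel_permute:
  assumes \<pi>: "\<pi> permutes (UNIV :: 'n::finite set)"
  shows "distr lborel borel (\<lambda>x::real^'n. \<chi> i. x $ \<pi> i) = lborel" (is "distr _ _ ?p = _")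
proof (rule sym, rule lborel_eqI)
  let ?q = "\<lambda>x::real^'n. \<chi> i. x $ inv \<pi> i"
  fix l u :: "real^'n" assume "\<And>b. b \<in> Basis \<Longrightarrow> l \<bullet> b \<le> u \<bullet> b"
  then have le: "l $ i \<le> u $ i" for i
    by (simp add: cart_eq_inner_axis axis_in_Basis_iff)
  have [measurable]: "?p \<in> borel_measurable borel"
    by (intro borel_measurable_continuous_onI continuous_intros)
  have "?p -` box l u = box (?q l) (?q u)"
    using permutes_inverses[OF \<pi>] by (auto simp: mem_box_cart) metis+
  then have "emeasure (distr lborel borel ?p) (box l u) = emeasure lborel (box (?q l) (?q u))"
    by (simp add: emeasure_distr)
  also have "\<dots> = (\<Prod>i\<in>UNIV. u $ inv \<pi> i - l $ inv \<pi> i)"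
    by (simp add: emeasure_lborel_box_vec le)
  also have "(\<Prod>i\<in>UNIV. u $ inv \<pi> i - l $ inv \<pi> i) = (\<Prod>i\<in>UNIV. u $ i - l $ i)"
    using permutes_inv[OF \<pi>] prod.permute[of "inv \<pi>" UNIV "\<lambda>i. u $ i - l $ i"]
    by (simp add: comp_def)
  also have "\<dots> = (\<Prod>b\<in>Basis. (u - l) \<bullet> b)"
    by (simp add: prod_Basis_vec inner_axis)
  finally show "emeasure (distr lborel borel ?p) (box l u) = (\<Prod>b\<in>Basis. (u - l) \<bullet> b)" .
qed simp

lemma abs_det_matrix_permute:
  assumes "\<pi> permutes (UNIV :: 'n::finite set)"
  shows "\<bar>det (matrix (\<lambda>x::real^'n. \<chi> i. x $ \<pi> i))\<bar> = 1"
proof -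
  have "matrix (\<lambda>x::real^'n. \<chi> i. x $ \<pi> i) = (\<chi> i. (mat 1 :: real^'n^'n) $ \<pi> i)"
    by (auto simp: matrix_def mat_def vec_eq_iff axis_def)
  then show ?thesis
    by (simp add: det_permute_rows[OF assms] abs_mult sign_def)
qed

lemma distr_lborel_add_coordinate:
  assumes "m \<noteq> n"
  shows "distr lborel borel (\<lambda>x::real^'n. \<chi> i. if i = m then x $ m + x $ n else x $ i) = lborel"
proof -
  have "(\<lambda>x::real^'n. \<chi> i. if i = m then x $ m + x $ n else x $ i) = (\<lambda>x. x + x $ n *\<^sub>R axis m 1)"
    by (auto simp: vec_eq_iff axis_def)
  moreover have "axis m 1 $ n = (0::real)"
    using assms by (simp add: axis_def)
  ultimately show ?thesis
    by (simp add: distr_lborel_shear axis_in_Basis_iff)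
qed

lemma det_matrix_add_coordinate:
  assumes "m \<noteq> n"
  shows "det (matrix (\<lambda>x::real^'n. \<chi> i. if i = m then x $ m + x $ n else x $ i)) = 1"
proof -
  have "matrix (\<lambda>x::real^'n. \<chi> i. if i = m then x $ m + x $ n else x $ i)
      = (\<chi> k. if k = m then row m (mat 1) + 1 *s row n (mat 1) else row k (mat 1))"
    by (auto simp: matrix_def mat_def vec_eq_iff axis_def row_def)
  then show ?thesis
    by (simp only: det_row_operation[OF assms] det_I)
qed

lemma lborel_diagonal:
  fixes c :: "'n::finite \<Rightarrow> real"
  defines "f \<equiv> \<lambda>x::real^'n. \<chi> i. c i * x $ i"
  assumes "det (matrix f) \<noteq> 0"
  shows "lborel = density (distr lborel borel f) (\<lambda>_. \<bar>det (matrix f)\<bar>)"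
proof -
  define c' where "c' b = c (THE i. b = axis i (1::real))" for b
  have c': "c' (axis i 1) = c i" for i by (simp add: c'_def axis_eq_axis)
  have f: "0 + (\<Sum>b\<in>Basis. (c' b * (x \<bullet> b)) *\<^sub>R b) = f x" for x :: "real^'n"
    by (rule euclidean_eqI) (auto simp: f_def inner_sum_left inner_Basis Basis_vec_def inner_axis c'
      if_distrib cong: if_cong)
  have det: "det (matrix f) = (\<Prod>i\<in>UNIV. c i)"
    unfolding f_def by (subst det_diagonal) (auto simp: matrix_def axis_def)
  then have "c i \<noteq> 0" for i
    using assms by simp
  then have "c' b \<noteq> 0" if "b \<in> Basis" for b
    using that by (auto simp: Basis_vec_def c')
  from lborel_affine_euclidean[of c' 0, OF this] show ?thesis
    by (simp only: f prod_Basis_vec c' det abs_prod)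
qed

lemma lborel_eq_density_distr_comp:
  fixes c d :: ennreal
  assumes [measurable]: "f \<in> borel_measurable borel" "g \<in> borel_measurable borel"
    and f: "lborel = density (distr lborel borel f) (\<lambda>_. c)"
    and g: "lborel = density (distr lborel borel g) (\<lambda>_. d)"
  shows "lborel = density (distr lborel borel (f \<circ> g)) (\<lambda>_. d * c)"
proof -
  have "lborel = density (distr (density (distr lborel borel g) (\<lambda>_. d)) borel f) (\<lambda>_. c)"
    using f unfolding g[symmetric] .
  also have "\<dots> = density (distr lborel borel (f \<circ> g)) (\<lambda>_. d * c)"
    by (simp add: density_density_eq distr_distr density_distr[of "\<lambda>_. d", symmetric])
  finally show ?thesis .
qed

text \<open>The volume formula \<open>measure_linear_image\<close> of the library is stated for well-ordered index
  types only.\<close>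
lemma lborel_linear:
  fixes f :: "real^'n \<Rightarrow> real^'n"
  assumes "linear f" "det (matrix f) \<noteq> 0"
  shows "lborel = density (distr lborel borel f) (\<lambda>_. \<bar>det (matrix f)\<bar>)"
proof -
  have "det (matrix f) \<noteq> 0 \<longrightarrow> lborel = density (distr lborel borel f) (\<lambda>_. \<bar>det (matrix f)\<bar>)"
    using \<open>linear f\<close>
  proof (induction f
      rule: induct_linear_elementary[consumes 1, case_names comp zeroes const swap idplus])
    case (comp f g)
    have "f \<in> borel_measurable borel" "g \<in> borel_measurable borel"
      using comp
      by (simp_all add: borel_measurable_continuous_onI linear_continuous_on linear_linear)
    note comp_density = lborel_eq_density_distr_comp[OF this]
    have det: "det (matrix (f \<circ> g)) = det (matrix g) * det (matrix f)"
      using comp by (simp add: matrix_compose det_mul)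
    show ?case
    proof
      assume "det (matrix (f \<circ> g)) \<noteq> 0"
      with det comp have "lborel
          = density (distr lborel borel (f \<circ> g)) (\<lambda>_. \<bar>det (matrix g)\<bar> * \<bar>det (matrix f)\<bar>)"
        unfolding ennreal_mult[OF abs_ge_zero abs_ge_zero] by (intro comp_density) auto
      then show "lborel = density (distr lborel borel (f \<circ> g)) (\<lambda>_. \<bar>det (matrix (f \<circ> g))\<bar>)"
        by (simp only: det abs_mult)
    qed
  next
    case (zeroes f i)
    then have "row i (matrix f) = 0"
      by (simp add: row_def matrix_def vec_eq_iff)
    then show ?case by (simp add: det_zero_row)
  next
    case (const c)
    show ?case using lborel_diagonal[of c] by blast
  next
    case (swap m n)
    show ?case
      by (simp add: distr_lborel_permute abs_det_matrix_permute permutes_swap_id density_1)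
  next
    case (idplus m n)
    then show ?case by (simp add: distr_lborel_add_coordinate det_matrix_add_coordinate density_1)
  qed
  with \<open>det (matrix f) \<noteq> 0\<close> show ?thesis by blast
qed

lemma borel_measurable_matrix_vector_mult [measurable (raw)]:
  fixes f :: "'a \<Rightarrow> real^'n" and A :: "real^'n^'m"
  assumes [measurable]: "f \<in> borel_measurable M"
  shows "(\<lambda>x. A *v f x) \<in> borel_measurable M"
proof -
  have [measurable]: "(*v) A \<in> borel_measurable borel"
    by (intro borel_measurable_continuous_onI linear_continuous_on matrix_vector_mul_bounded_linear)
  show ?thesis by measurable
qed

lemma lborel_affine_matrix:
  fixes A :: "real^'n^'n" and t :: "real^'n"
  assumes "invertible A"
  shows "lborel = density (distr lborel borel (\<lambda>x. t + A *v x)) (\<lambda>_. \<bar>det A\<bar>)"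
proof -
  have "lborel = density (distr lborel borel ((*v) A)) (\<lambda>_. \<bar>det A\<bar>)"
    using lborel_linear[OF matrix_vector_mul_linear] assms by (simp add: invertible_det_nz)
  moreover have "lborel = density (distr lborel borel (\<lambda>x. t + x)) (\<lambda>_. 1)"
    using lborel_affine[of 1 t] by simp
  ultimately show ?thesis
    using lborel_eq_density_distr_comp[of "\<lambda>x. t + x" "(*v) A" 1 "\<bar>det A\<bar>"] by (simp add: comp_def)
qed

lemma AE_lborel_affine:
  fixes t :: "'a::euclidean_space"
  assumes "c \<noteq> 0" and [measurable]: "Measurable.pred borel P" and "AE x in lborel. P x"
  shows "AE x in lborel. P (t + c *\<^sub>R x)"
  using assms(3) \<open>c \<noteq> 0\<close>
  by (subst (asm) lborel_affine[OF \<open>c \<noteq> 0\<close>, of t]) (simp add: AE_density AE_distr_iff)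

section \<open>Product measures and convolutions\<close>

lemma product_sigma_finite_prob_space: "(\<And>i. prob_space (M i)) \<Longrightarrow> product_sigma_finite M"
  by (simp add: product_sigma_finite_def prob_space_imp_sigma_finite)

lemma measurable_PiM_uncurry:
  "(\<lambda>Y. restrict (case_prod Y) (I \<times> J)) \<in> PiM I (\<lambda>i. PiM J (\<lambda>j. M (i, j))) \<rightarrow>\<^sub>M PiM (I \<times> J) M"
proof (rule measurable_restrict)
  fix p assume "p \<in> I \<times> J"
  then obtain i j where p: "p = (i, j)" "i \<in> I" "j \<in> J" by blast
  have "(\<lambda>Y. Y i) \<in> PiM I (\<lambda>i. PiM J (\<lambda>j. M (i, j))) \<rightarrow>\<^sub>M PiM J (\<lambda>j. M (i, j))"
    "(\<lambda>y. y j) \<in> PiM J (\<lambda>j. M (i, j)) \<rightarrow>\<^sub>M M (i, j)"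
    using p by (auto intro: measurable_component_singleton)
  from measurable_compose[OF this]
  show "(\<lambda>Y. case_prod Y p) \<in> PiM I (\<lambda>i. PiM J (\<lambda>j. M (i, j))) \<rightarrow>\<^sub>M M p"
    by (simp add: p)
qed

lemma distr_PiM_uncurry:
  assumes I: "finite I" and J: "finite J" and M: "product_sigma_finite M"
  shows "distr (PiM I (\<lambda>i. PiM J (\<lambda>j. M (i, j)))) (PiM (I \<times> J) M)
      (\<lambda>Y. restrict (case_prod Y) (I \<times> J)) = PiM (I \<times> J) M"
    (is "distr ?P _ ?u = _")
proof -
  interpret product_sigma_finite M by fact
  interpret row: product_sigma_finite "\<lambda>j. M (i, j)" for i
    by (simp add: product_sigma_finite_def sigma_finite_measures)
  interpret rows: product_sigma_finite "\<lambda>i. PiM J (\<lambda>j. M (i, j))"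
    using row.sigma_finite[OF J] by (simp add: product_sigma_finite_def)
  show ?thesis
  proof (rule PiM_eqI)
    fix A assume A: "\<And>p. p \<in> I \<times> J \<Longrightarrow> A p \<in> sets (M p)"
    have "x \<in> space (M (i, j))" if "i \<in> I" "j \<in> J" "x \<in> A (i, j)" for i j x
      using A[of "(i, j)", THEN sets.sets_into_space] that by auto
    then have "?u -` PiE (I \<times> J) A \<inter> space ?P = PiE I (\<lambda>i. PiE J (\<lambda>j. A (i, j)))"
      by (auto simp: space_PiM PiE_iff)
    then have "emeasure (distr ?P (PiM (I \<times> J) M) ?u) (PiE (I \<times> J) A)
        = emeasure ?P (PiE I (\<lambda>i. PiE J (\<lambda>j. A (i, j))))"
      using I J A
      by (subst emeasure_distr[OF measurable_PiM_uncurry]) (auto intro!: sets_PiM_I_finite)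
    also have "\<dots> = (\<Prod>i\<in>I. \<Prod>j\<in>J. emeasure (M (i, j)) (A (i, j)))"
      using I J A
      by (subst rows.emeasure_PiM) (auto intro!: prod.cong sets_PiM_I_finite row.emeasure_PiM)
    also have "\<dots> = (\<Prod>p\<in>I \<times> J. emeasure (M p) (A p))"
      by (simp add: prod.cartesian_product)
    finally show "emeasure (distr ?P (PiM (I \<times> J) M) ?u) (PiE (I \<times> J) A) = \<dots>" .
  qed (use I J in auto)
qed

lemma distr_PiM_componentwise:
  assumes I: "finite I" and M: "\<And>i. prob_space (M i)" and g: "\<And>i. g i \<in> M i \<rightarrow>\<^sub>M N i"
  shows "distr (PiM I M) (PiM I N) (\<lambda>x. \<lambda>i\<in>I. g i (x i)) = PiM I (\<lambda>i. distr (M i) (N i) (g i))"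
    (is "?D = ?P")
proof -
  interpret M: product_sigma_finite M
    using M by (rule product_sigma_finite_prob_space)
  interpret N: product_sigma_finite "\<lambda>i. distr (M i) (N i) (g i)"
    by (intro product_sigma_finite_prob_space prob_space.prob_space_distr[OF M g])
  have measurable: "(\<lambda>x. \<lambda>i\<in>I. g i (x i)) \<in> PiM I M \<rightarrow>\<^sub>M PiM I N"
    by (intro measurable_restrict measurable_compose[OF _ g] measurable_component_singleton)
  show ?thesis
  proof (rule N.PiM_eqI[OF I])
    fix A assume "\<And>i. i \<in> I \<Longrightarrow> A i \<in> sets (distr (M i) (N i) (g i))"
    then have A: "\<And>i. i \<in> I \<Longrightarrow> A i \<in> sets (N i)" by simp
    have "(\<lambda>x. \<lambda>i\<in>I. g i (x i)) -` PiE I A \<inter> space (PiM I M) = PiE I (\<lambda>i. g i -` A i \<inter> space (M i))"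
      by (auto simp: space_PiM PiE_iff)
    then have "emeasure ?D (PiE I A) = emeasure (PiM I M) (PiE I (\<lambda>i. g i -` A i \<inter> space (M i)))"
      using I A by (subst emeasure_distr[OF measurable]) (auto intro!: sets_PiM_I_finite)
    also have "\<dots> = (\<Prod>i\<in>I. emeasure (distr (M i) (N i) (g i)) (A i))"
      using I A g by (subst M.emeasure_PiM) (auto intro!: prod.cong simp: emeasure_distr)
    finally show "emeasure ?D (PiE I A) = (\<Prod>i\<in>I. emeasure (distr (M i) (N i) (g i)) (A i))" .
  qed (simp cong: sets_PiM_cong)
qed

lemma distr_PiM_rows:
  assumes I: "finite I" and J: "finite J" and M: "\<And>p. prob_space (M p)"
    and g: "\<And>i. g i \<in> PiM J (\<lambda>j. M (i, j)) \<rightarrow>\<^sub>M N i"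
  shows "distr (PiM (I \<times> J) M) (PiM I N) (\<lambda>X. \<lambda>i\<in>I. g i (\<lambda>j\<in>J. X (i, j)))
    = PiM I (\<lambda>i. distr (PiM J (\<lambda>j. M (i, j))) (N i) (g i))"
proof -
  let ?P = "PiM I (\<lambda>i. PiM J (\<lambda>j. M (i, j)))" and ?u = "\<lambda>Y. restrict (case_prod Y) (I \<times> J)"
    and ?rows = "\<lambda>X. \<lambda>i\<in>I. g i (\<lambda>j\<in>J. X (i, j))"
  have rows: "?rows \<in> PiM (I \<times> J) M \<rightarrow>\<^sub>M PiM I N"
    by (intro measurable_restrict measurable_compose[OF _ g] measurable_component_singleton) auto
  have "distr (PiM (I \<times> J) M) (PiM I N) ?rows = distr ?P (PiM I N) (?rows \<circ> ?u)"
    by (subst distr_PiM_uncurry[OF I J product_sigma_finite_prob_space[OF M], symmetric])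
      (rule distr_distr[OF rows measurable_PiM_uncurry])
  also have "\<dots> = distr ?P (PiM I N) (\<lambda>Y. \<lambda>i\<in>I. g i (Y i))"
  proof (rule distr_cong)
    fix Y assume "Y \<in> space ?P"
    then have "(\<lambda>j\<in>J. ?u Y (i, j)) = Y i" if "i \<in> I" for i
      using that by (auto simp: space_PiM PiE_iff extensional_def fun_eq_iff)
    then show "(?rows \<circ> ?u) Y = (\<lambda>i\<in>I. g i (Y i))"
      by (auto simp only: comp_apply intro!: restrict_ext)
  qed auto
  also have "\<dots> = PiM I (\<lambda>i. distr (PiM J (\<lambda>j. M (i, j))) (N i) (g i))"
    by (intro distr_PiM_componentwise I prob_space_PiM M g)
  finally show ?thesis .
qed

lemma convolution_density_lborel:
  fixes f g :: "'a::ordered_euclidean_space \<Rightarrow> ennreal"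
  assumes [measurable]: "f \<in> borel_measurable borel" "g \<in> borel_measurable borel"
    and fin: "finite_measure (density lborel f)" "finite_measure (density lborel g)"
  shows "(density lborel f \<star> density lborel g) = density lborel (\<lambda>x. \<integral>\<^sup>+y. f (x - y) * g y \<partial>lborel)"
    (is "?l = ?r")
proof (rule measure_eqI)
  fix A assume "A \<in> sets ?l"
  then have [measurable]: "A \<in> sets borel" by simp
  have translate: "(\<integral>\<^sup>+x. f x * indicator A (y + x) \<partial>lborel)
      = (\<integral>\<^sup>+x. f (x - y) * indicator A x \<partial>lborel)" for y
    by (subst (2) lborel_affine[of 1 y])
      (simp_all add: nn_integral_density nn_integral_distr density_1)
  have "emeasure ?l A = emeasure (density lborel g \<star> density lborel f) A"
    using fin by (simp add: convolution_commutative)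
  also have "\<dots> = (\<integral>\<^sup>+y. g y * (\<integral>\<^sup>+x. f x * indicator A (y + x) \<partial>lborel) \<partial>lborel)"
    using fin by (simp add: convolution_emeasure' nn_integral_density)
  also have "\<dots> = (\<integral>\<^sup>+y. \<integral>\<^sup>+x. f (x - y) * g y * indicator A x \<partial>lborel \<partial>lborel)"
    by (simp add: translate ac_simps flip: nn_integral_cmult)
  also have "\<dots> = (\<integral>\<^sup>+x. \<integral>\<^sup>+y. f (x - y) * g y * indicator A x \<partial>lborel \<partial>lborel)"
    by (rule lborel_pair.Fubini') simp
  also have "\<dots> = emeasure ?r A"
    by (simp add: emeasure_density nn_integral_multc)
  finally show "emeasure ?l A = emeasure ?r A" .
qed simp

lemma distr_sum_PiM_insert:
  fixes M :: "'i \<Rightarrow> ('a::ordered_euclidean_space) measure"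
  assumes I: "finite I" "i \<notin> I" and M: "\<And>i. prob_space (M i)"
    and sets[measurable_cong]: "\<And>i. sets (M i) = sets borel"
  shows "distr (PiM (insert i I) M) borel (\<lambda>x. \<Sum>j\<in>insert i I. x j)
      = (M i \<star> distr (PiM I M) borel (\<lambda>x. \<Sum>j\<in>I. x j))"
proof -
  let ?S = "\<lambda>x. \<Sum>j\<in>I. x j :: 'a" and ?P = "M i \<Otimes>\<^sub>M PiM I M"
  have "distr (PiM (insert i I) M) borel (\<lambda>x. \<Sum>j\<in>insert i I. x j)
      = distr ?P borel (\<lambda>(y, x). \<Sum>j\<in>insert i I. (x(i := y)) j)"
    by (subst distr_pair_PiM_eq_PiM[symmetric])
      (use M in \<open>auto simp: distr_distr comp_def split_def\<close>)
  also have "\<dots> = distr ?P borel (\<lambda>(y, x). y + ?S x)"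
  proof -
    have "(\<Sum>j\<in>I. (x(i := y)) j) = ?S x" for x y
      using I by (intro sum.cong) auto
    then show ?thesis using I by simp
  qed
  also have "\<dots> = distr (distr ?P (borel \<Otimes>\<^sub>M borel) (\<lambda>(y, x). (y, ?S x))) borel (\<lambda>(y, s). y + s)"
    by (subst distr_distr) (auto simp: comp_def split_def)
  also have "distr ?P (borel \<Otimes>\<^sub>M borel) (\<lambda>(y, x). (y, ?S x))
      = distr (M i) borel (\<lambda>y. y) \<Otimes>\<^sub>M distr (PiM I M) borel ?S"
  proof (rule pair_measure_distr[symmetric])
    show "sigma_finite_measure (distr (PiM I M) borel ?S)"
      by (intro prob_space_imp_sigma_finite prob_space.prob_space_distr prob_space_PiM M) measurable
  qed measurable
  also have "distr (M i) borel (\<lambda>y. y) = M i"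
    by (rule distr_id2) (simp add: sets)
  finally show ?thesis by (simp add: convolution_def)
qed

lemma PiM_density:
  assumes I: "finite I" and "product_sigma_finite M"
    and "product_sigma_finite (\<lambda>i. density (M i) (f i))"
    and f[measurable]: "\<And>i. f i \<in> borel_measurable (M i)"
  shows "PiM I (\<lambda>i. density (M i) (f i)) = density (PiM I M) (\<lambda>x. \<Prod>i\<in>I. f i (x i))"
proof -
  interpret M: product_sigma_finite M by fact
  interpret D: product_sigma_finite "\<lambda>i. density (M i) (f i)" by fact
  have [measurable]: "(\<lambda>x. \<Prod>i\<in>I. f i (x i)) \<in> borel_measurable (PiM I M)"
    by (intro borel_measurable_prod_ennreal measurable_compose[OF _ f]
          measurable_component_singleton)
  have "density (PiM I M) (\<lambda>x. \<Prod>i\<in>I. f i (x i)) = PiM I (\<lambda>i. density (M i) (f i))"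
  proof (rule D.PiM_eqI[OF I])
    show "sets (density (PiM I M) (\<lambda>x. \<Prod>i\<in>I. f i (x i))) = sets (PiM I (\<lambda>i. density (M i) (f i)))"
      by (simp cong: sets_PiM_cong)
    fix A assume "\<And>i. i \<in> I \<Longrightarrow> A i \<in> sets (density (M i) (f i))"
    then have A[measurable]: "\<And>i. i \<in> I \<Longrightarrow> A i \<in> sets (M i)" by simp
    have "PiE I A \<in> sets (PiM I M)" using I A by (auto intro!: sets_PiM_I_finite)
    then have "emeasure (density (PiM I M) (\<lambda>x. \<Prod>i\<in>I. f i (x i))) (PiE I A)
        = (\<integral>\<^sup>+x. (\<Prod>i\<in>I. f i (x i)) * indicator (PiE I A) x \<partial>PiM I M)"
      by (simp add: emeasure_density)
    also have "\<dots> = (\<integral>\<^sup>+x. (\<Prod>i\<in>I. f i (x i) * indicator (A i) (x i)) \<partial>PiM I M)"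
    proof (rule nn_integral_cong)
      fix x assume "x \<in> space (PiM I M)"
      then have "indicator (PiE I A) x = (\<Prod>i\<in>I. indicator (A i) (x i) :: ennreal)"
        using I by (auto simp: indicator_def space_PiM PiE_iff)
      then show "(\<Prod>i\<in>I. f i (x i)) * indicator (PiE I A) x
          = (\<Prod>i\<in>I. f i (x i) * indicator (A i) (x i))"
        by (simp add: prod.distrib)
    qed
    also have "\<dots> = (\<Prod>i\<in>I. \<integral>\<^sup>+x. f i x * indicator (A i) x \<partial>M i)"
      using I by (intro M.product_nn_integral_prod) auto
    also have "\<dots> = (\<Prod>i\<in>I. emeasure (density (M i) (f i)) (A i))"
      by (intro prod.cong) (auto simp: emeasure_density)
    finally show "emeasure (density (PiM I M) (\<lambda>x. \<Prod>i\<in>I. f i (x i))) (PiE I A)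
      = (\<Prod>i\<in>I. emeasure (density (M i) (f i)) (A i))" .
  qed
  then show ?thesis by simp
qed

lemma PiM_density_component:
  assumes I: "finite I" "k \<in> I" and M: "product_sigma_finite M"
    and f: "f \<in> borel_measurable (M k)" "sigma_finite_measure (density (M k) f)"
  shows "PiM I (M(k := density (M k) f)) = density (PiM I M) (\<lambda>x. f (x k))"
proof -
  let ?g = "\<lambda>i. if i = k then f else (\<lambda>_. 1)"
  have density: "density (M i) (?g i) = (M(k := density (M k) f)) i" for i
    by (simp add: density_1)
  have "PiM I (\<lambda>i. density (M i) (?g i)) = density (PiM I M) (\<lambda>x. \<Prod>i\<in>I. ?g i (x i))"
  proof (rule PiM_density[OF I(1) M])
    show "product_sigma_finite (\<lambda>i. density (M i) (?g i))"
      unfolding density using M f(2) by (simp add: product_sigma_finite_def)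
  qed (simp add: f(1))
  moreover have "(\<lambda>x. \<Prod>i\<in>I. ?g i (x i)) = (\<lambda>x. f (x k))"
    using I by (simp add: if_distrib[of "\<lambda>f. f _"] prod.delta cong: if_cong)
  ultimately show ?thesis unfolding density by (simp add: fun_upd_def)
qed

lemma (in sigma_finite_measure) pred_AE [measurable (raw)]:
  assumes [measurable]: "Measurable.pred (N \<Otimes>\<^sub>M M) (\<lambda>(x, y). P x y)"
  shows "Measurable.pred N (\<lambda>x. AE y in M. P x y)"
proof -
  have "(AE y in M. P x y) \<longleftrightarrow> (\<integral>\<^sup>+y. (if P x y then 0 else 1) \<partial>M) = 0"
    if [measurable]: "x \<in> space N" for x
    by (subst nn_integral_0_iff_AE) auto
  then show ?thesis
    by (subst measurable_cong) (assumption, measurable)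
qed

lemma (in product_sigma_finite) AE_PiM_insert_iff:
  assumes I: "finite I" "i \<notin> I" and [measurable]: "Measurable.pred (PiM (insert i I) M) P"
  shows "(AE x in PiM (insert i I) M. P x) \<longleftrightarrow> (AE x in PiM I M. AE y in M i. P (x(i := y)))"
proof -
  interpret M: sigma_finite_measure "M i" by (rule sigma_finite_measures)
  let ?f = "\<lambda>x. if P x then 0 else 1 :: ennreal"
  have [measurable]: "?f \<in> borel_measurable (PiM (insert i I) M)" by measurable
  have [measurable]: "(\<lambda>y. ?f (x(i := y))) \<in> borel_measurable (M i)" if "x \<in> space (PiM I M)" for x
    using measurable_compose[OF measurable_component_update[OF that I(2)], of ?f borel] by simp
  have "(AE x in PiM (insert i I) M. P x) \<longleftrightarrow> (\<integral>\<^sup>+x. ?f x \<partial>PiM (insert i I) M) = 0"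
    by (subst nn_integral_0_iff_AE) auto
  also have "\<dots> \<longleftrightarrow> (\<integral>\<^sup>+x. \<integral>\<^sup>+y. ?f (x(i := y)) \<partial>M i \<partial>PiM I M) = 0"
    by (subst product_nn_integral_insert[OF I]) auto
  also have "\<dots> \<longleftrightarrow> (AE x in PiM I M. (\<integral>\<^sup>+y. ?f (x(i := y)) \<partial>M i) = 0)"
    by (rule nn_integral_0_iff_AE) measurable
  also have "\<dots> \<longleftrightarrow> (AE x in PiM I M. AE y in M i. P (x(i := y)))"
    by (rule AE_cong) (simp add: nn_integral_0_iff_AE)
  finally show ?thesis .
qed

section \<open>Positive definite matrices\<close>

lemma matrix_inv_unique:
  fixes A B :: "real^'n^'n"
  assumes "A ** B = mat 1"
  shows "matrix_inv A = B"
proof -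
  have "B ** A = mat 1" using assms matrix_left_right_inverse by blast
  then have "invertible A" using assms invertible_def by blast
  then have "matrix_inv A ** A = mat 1"
    unfolding invertible_def matrix_inv_def by (rule someI2_ex) auto
  then have "matrix_inv A ** A ** B = B" by simp
  then show ?thesis using assms by (simp flip: matrix_mul_assoc)
qed

lemma matrix_inv_right:
  fixes A :: "real^'n^'n"
  assumes "invertible A"
  shows "A ** matrix_inv A = mat 1"
  using assms matrix_inv_unique unfolding invertible_def by blast

lemma det_scaleR:
  fixes A :: "real^'n^'n"
  shows "det (c *\<^sub>R A) = c ^ CARD('n) * det A"
proof -
  have "c *\<^sub>R A = (\<chi> i. c *s A $ i)" by (simp add: vec_eq_iff)
  then show ?thesis by (simp add: det_rows_mul)
qed

lemma inner_matrix_symmetric: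
  fixes S :: "real^'n^'n"
  assumes "transpose S = S"
  shows "x \<bullet> (S *v y) = y \<bullet> (S *v x)"
proof -
  have "x \<bullet> (S *v y) = (transpose S *v x) \<bullet> y" by (simp add: dot_lmul_matrix)
  then show ?thesis using assms by (simp add: inner_commute)
qed

lemma pos_def_mat_scaleR: "pos_def_mat S \<Longrightarrow> 0 < c \<Longrightarrow> pos_def_mat (c *\<^sub>R S)"
  by (simp add: pos_def_mat_def transpose_scalar flip: scaleR_matrix_vector_assoc)

lemma pos_def_mat_orthonormal_family:
  fixes S :: "real^'n^'n"
  assumes S: "pos_def_mat S" and "finite I"
  shows "\<exists>e. \<forall>i\<in>I. \<forall>j\<in>I. e i \<bullet> (S *v e j) = (if i = (j::'n) then 1 else 0)"
  using \<open>finite I\<close>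
proof (induction I)
  case (insert k I)
  then obtain e where e: "\<And>i j. i \<in> I \<Longrightarrow> j \<in> I \<Longrightarrow> e i \<bullet> (S *v e j) = (if i = j then 1 else 0)"
    by blast
  let ?V = "(\<lambda>i. S *v e i) ` I"
  have "dim ?V \<le> card I"
    using insert.hyps(1) by (intro dim_le_card'[THEN order_trans] card_image_le) auto
  also have "card I < DIM(real^'n)"
    using insert.hyps card_mono[of UNIV "insert k I"] by simp
  finally obtain x where "x \<noteq> 0" and x: "\<And>y. y \<in> span ?V \<Longrightarrow> orthogonal x y"
    using orthogonal_to_subspace_exists by blast
  define s where "s = x \<bullet> (S *v x)"
  have "s > 0" using S \<open>x \<noteq> 0\<close> by (simp add: s_def pos_def_mat_def)
  define w where "w = (1 / sqrt s) *\<^sub>R x"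
  have w_orthogonal: "w \<bullet> (S *v e i) = 0" if "i \<in> I" for i
    using x[OF span_base, of "S *v e i"] that by (simp add: w_def orthogonal_def)
  have "e i \<bullet> (S *v w) = 0" if "i \<in> I" for i
    using w_orthogonal[OF that] S by (simp add: pos_def_mat_def inner_matrix_symmetric[of S "e i"])
  moreover have "w \<bullet> (S *v w) = 1"
    using \<open>s > 0\<close> by (simp add: w_def matrix_vector_mult_scaleR flip: s_def)
  ultimately show ?case
    using e w_orthogonal insert.hyps(2) by (intro exI[of _ "e(k := w)"]) auto
qed simp

lemma pos_def_mat_whitening:
  fixes S :: "real^'n^'n"
  assumes "pos_def_mat S"
  obtains B :: "real^'n^'n" where "B ** S ** transpose B = mat 1"
proof -
  obtain e where e: "\<And>i j. e i \<bullet> (S *v e j) = (if i = (j::'n) then 1 else 0)"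
    using pos_def_mat_orthonormal_family[OF assms finite[of UNIV]] by blast
  define B where "B = (\<chi> i. e i)"
  have "(B ** (S ** transpose B)) $ i $ j = e i \<bullet> (S *v e j)" for i j
    unfolding matrix_matrix_mult_def matrix_vector_mult_def inner_vec_def transpose_def B_def
    by simp
  then show ?thesis
    by (intro that[of B]) (simp add: vec_eq_iff e mat_def flip: matrix_mul_assoc)
qed

lemma pos_def_mat_det_pos:
  fixes S :: "real^'n^'n"
  assumes "pos_def_mat S"
  shows "det S > 0"
proof -
  obtain B :: "real^'n^'n" where "B ** S ** transpose B = mat 1"
    using pos_def_mat_whitening[OF assms] .
  from arg_cong[OF this, of det] have "(det B)\<^sup>2 * det S = 1"
    by (simp add: det_mul det_transpose power2_eq_square mult_ac)
  then show ?thesis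
    using zero_less_mult_pos[of "(det B)\<^sup>2" "det S"] by (cases "det B = 0") auto
qed

lemma pos_def_mat_invertible: "pos_def_mat S \<Longrightarrow> invertible S"
  using pos_def_mat_det_pos[of S] by (simp add: invertible_det_nz)

lemma matrix_inv_scaleR:
  fixes S :: "real^'n^'n"
  assumes "invertible S" "c \<noteq> 0"
  shows "matrix_inv (c *\<^sub>R S) = (1 / c) *\<^sub>R matrix_inv S"
  using assms
  by (intro matrix_inv_unique)
    (simp add: matrix_scalar_ac matrix_inv_right flip: scalar_matrix_assoc)

lemma transpose_matrix_inv:
  fixes S :: "real^'n^'n"
  assumes "invertible S"
  shows "transpose (matrix_inv S) = matrix_inv (transpose S)"
proof (rule matrix_inv_unique[symmetric])
  have "matrix_inv S ** S = mat 1"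
    using matrix_inv_right[OF assms] by (rule matrix_left_right_inverse1)
  then show "transpose S ** transpose (matrix_inv S) = mat 1"
    by (simp flip: matrix_transpose_mul)
qed

lemma matrix_inv_congruence:
  fixes A S :: "real^'n^'n"
  assumes "invertible A" "invertible S"
  shows "transpose A ** matrix_inv (A ** S ** transpose A) ** A = matrix_inv S"
proof -
  have A: "A ** matrix_inv A = mat 1" "matrix_inv A ** A = mat 1"
    using assms matrix_inv_right matrix_left_right_inverse by blast+
  then have At: "transpose A ** transpose (matrix_inv A) = mat 1"
    by (simp flip: matrix_transpose_mul)
  have "A ** S ** transpose A ** (transpose (matrix_inv A) ** matrix_inv S ** matrix_inv A)
      = A ** (S ** (transpose A ** transpose (matrix_inv A)) ** matrix_inv S) ** matrix_inv A"
    by (simp only: matrix_mul_assoc)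
  then have "matrix_inv (A ** S ** transpose A)
      = transpose (matrix_inv A) ** matrix_inv S ** matrix_inv A"
    using A At assms by (intro matrix_inv_unique) (simp add: matrix_inv_right)
  then have "transpose A ** matrix_inv (A ** S ** transpose A) ** A
      = (transpose A ** transpose (matrix_inv A)) ** matrix_inv S ** (matrix_inv A ** A)"
    by (simp only: matrix_mul_assoc)
  then show ?thesis by (simp add: A At)
qed

lemma inner_matrix_diff_scaleR:
  fixes M :: "real^'n^'n"
  assumes "transpose M = M"
  shows "(u - c *\<^sub>R v) \<bullet> (M *v (u - c *\<^sub>R v))
      = u \<bullet> (M *v u) - 2 * c * (u \<bullet> (M *v v)) + c\<^sup>2 * (v \<bullet> (M *v v))"
  using inner_matrix_symmetric[OF assms, of v u]
  by (simp add: matrix_vector_mult_diff_distrib matrix_vector_mult_scaleR inner_diff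
        power2_eq_square algebra_simps)

lemma pos_def_mat_transpose_inv: "pos_def_mat S \<Longrightarrow> transpose (matrix_inv S) = matrix_inv S"
  by (simp add: transpose_matrix_inv pos_def_mat_invertible) (simp add: pos_def_mat_def)

lemma inner_matrix_complete_square:
  fixes M :: "real^'n^'n" and u v :: "real^'n"
  assumes M: "transpose M = M" and a: "a > 0" and b: "b > 0"
  defines "w \<equiv> v - (b / (a + b)) *\<^sub>R u"
  shows "(u - v) \<bullet> (M *v (u - v)) / (2 * a) + v \<bullet> (M *v v) / (2 * b)
    = u \<bullet> (M *v u) / (2 * (a + b)) + w \<bullet> (M *v w) / (2 * (a * b / (a + b)))"
proof -
  have expand: "(u - v) \<bullet> (M *v (u - v)) = u \<bullet> (M *v u) - 2 * (u \<bullet> (M *v v)) + v \<bullet> (M *v v)"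
    using inner_matrix_diff_scaleR[OF M, of u 1 v] by simp
  have "a + b > 0" using a b by simp
  then show ?thesis
    unfolding expand w_def inner_matrix_diff_scaleR[OF M] inner_matrix_symmetric[OF M, of v u]
    using a b by (simp add: divide_simps power2_eq_square) (simp add: algebra_simps)
qed

section \<open>Multivariate normal distributions\<close>

lemma borel_measurable_gauss_density [measurable]: "gauss_density mu S \<in> borel_measurable borel"
  unfolding gauss_density_def by measurable

lemma sets_gauss_measure [simp, measurable_cong]: "sets (gauss_measure mu S) = sets borel"
  and space_gauss_measure [simp]: "space (gauss_measure mu S) = UNIV"
  by (simp_all add: gauss_measure_def)

lemma gauss_density_pos: "pos_def_mat S \<Longrightarrow> gauss_density mu S x > 0"
  by (simp add: gauss_density_def pos_def_mat_det_pos)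

lemma gauss_density_affine_matrix:
  fixes A S :: "real^'n^'n"
  assumes A: "invertible A" and S: "invertible S"
  shows "\<bar>det A\<bar> * gauss_density (t + A *v m) (A ** S ** transpose A) (t + A *v x)
      = gauss_density m S x"
proof -
  let ?S' = "A ** S ** transpose A"
  have "(A *v v) \<bullet> (matrix_inv ?S' *v (A *v v)) = v \<bullet> (matrix_inv S *v v)" for v
    unfolding matrix_inv_congruence[OF A S, symmetric]
    by (metis dot_lmul_matrix matrix_vector_mul_assoc vector_transpose_matrix)
  moreover have "t + A *v x - (t + A *v m) = A *v (x - m)"
    by (simp add: matrix_vector_mult_diff_distrib)
  moreover have "sqrt ((2 * pi) ^ CARD('n) * det ?S')
      = \<bar>det A\<bar> * sqrt ((2 * pi) ^ CARD('n) * det S)"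
  proof -
    have "(2 * pi) ^ CARD('n) * det ?S' = (det A)\<^sup>2 * ((2 * pi) ^ CARD('n) * det S)"
      by (simp add: det_mul power2_eq_square)
    then show ?thesis by (simp only: real_sqrt_mult real_sqrt_abs)
  qed
  ultimately have "gauss_density (t + A *v m) ?S' (t + A *v x)
      = exp (- ((x - m) \<bullet> (matrix_inv S *v (x - m))) / 2)
          / (\<bar>det A\<bar> * sqrt ((2 * pi) ^ CARD('n) * det S))"
    unfolding gauss_density_def by (simp only:)
  then show ?thesis
    using A by (simp add: gauss_density_def invertible_det_nz)
qed

lemma distr_gauss_measure_affine_matrix:
  fixes A S :: "real^'n^'n"
  assumes A: "invertible A" and S: "invertible S"
  shows "distr (gauss_measure m S) borel (\<lambda>x. t + A *v x)
      = gauss_measure (t + A *v m) (A ** S ** transpose A)"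
proof -
  let ?g = "\<lambda>x. ennreal (gauss_density (t + A *v m) (A ** S ** transpose A) x)"
    and ?T = "\<lambda>x. t + A *v x"
  have "gauss_measure (t + A *v m) (A ** S ** transpose A)
      = density (density (distr lborel borel ?T) (\<lambda>_. \<bar>det A\<bar>)) ?g"
    unfolding gauss_measure_def lborel_affine_matrix[OF A, of t, symmetric] ..
  also have "\<dots> = distr (density lborel (\<lambda>x. ennreal \<bar>det A\<bar> * ?g (?T x))) borel ?T"
    by (subst density_density_eq) (auto simp: density_distr)
  also have "\<dots> = distr (gauss_measure m S) borel ?T"
    by (simp add: gauss_measure_def gauss_density_affine_matrix[OF A S] flip: ennreal_mult')
  finally show ?thesis ..
qed

lemma gauss_density_mat_1:
  fixes x :: "real^'n"
  shows "gauss_density 0 (mat 1) x = (\<Prod>b\<in>Basis. normal_density 0 1 (x \<bullet> b))"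
proof -
  have "matrix_inv (mat 1 :: real^'n^'n) = mat 1" by (simp add: matrix_inv_unique)
  moreover have "(\<Sum>b\<in>Basis. - (x \<bullet> b)\<^sup>2 / 2) = - (x \<bullet> x) / 2"
    by (subst euclidean_inner[of x x]) (simp add: sum_negf sum_divide_distrib power2_eq_square)
  moreover have "sqrt ((2 * pi) ^ CARD('n) * det (mat 1 :: real^'n^'n)) = sqrt (2 * pi) ^ CARD('n)"
    by (simp only: det_I mult_1_right real_sqrt_power)
  ultimately have "gauss_density 0 (mat 1) x
      = (\<Prod>b\<in>Basis. exp (- (x \<bullet> b)\<^sup>2 / 2)) / sqrt (2 * pi) ^ CARD('n)"
    unfolding gauss_density_def by (simp only: exp_sum[OF finite_Basis, symmetric]) simp
  then show ?thesis
    by (simp add: normal_density_def prod_dividef)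
qed

lemma prob_space_gauss_measure:
  fixes S :: "real^'n^'n"
  assumes "pos_def_mat S"
  shows "prob_space (gauss_measure mu S)"
proof -
  have "(\<integral>\<^sup>+x. ennreal (gauss_density 0 (mat 1) (x :: real^'n)) \<partial>lborel)
      = (\<Prod>b\<in>(Basis :: (real^'n) set). \<integral>\<^sup>+x. ennreal (normal_density 0 1 x) \<partial>lborel)"
    unfolding gauss_density_mat_1
    by (subst nn_integral_lborel_prod[symmetric]) (simp_all add: prod_ennreal)
  also have "\<dots> = 1"
    by (simp add: nn_integral_eq_integral)
  finally have standard: "prob_space (gauss_measure 0 (mat 1) :: (real^'n) measure)"
    by (intro prob_spaceI) (simp add: gauss_measure_def emeasure_density)
  obtain B :: "real^'n^'n" where B: "B ** S ** transpose B = mat 1"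
    using pos_def_mat_whitening[OF assms] .
  then have "det B \<noteq> 0"
    by (metis det_I det_mul mult_zero_left zero_neq_one)
  then have "distr (gauss_measure mu S) borel (\<lambda>x. - (B *v mu) + B *v x) = gauss_measure 0 (mat 1)"
    using distr_gauss_measure_affine_matrix[of B S mu "- (B *v mu)"]
      pos_def_mat_invertible[OF assms] B
    by (simp add: invertible_det_nz)
  then show ?thesis
    using standard prob_space_distrD[of "\<lambda>x. - (B *v mu) + B *v x" "gauss_measure mu S" borel]
    by simp
qed

lemma distr_gauss_measure_affine:
  fixes S :: "real^'n^'n"
  assumes "pos_def_mat S" "c \<noteq> 0"
  shows "distr (gauss_measure m S) borel (\<lambda>x. t + c *\<^sub>R x) = gauss_measure (t + c *\<^sub>R m) (c\<^sup>2 *\<^sub>R S)"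
proof -
  let ?C = "c *\<^sub>R mat 1 :: real^'n^'n"
  have "?C *v x = c *\<^sub>R x" for x
    by (simp flip: scaleR_matrix_vector_assoc)
  moreover have "invertible ?C"
    using \<open>c \<noteq> 0\<close> by (simp add: invertible_det_nz det_scaleR)
  moreover have "?C ** S ** transpose ?C = c\<^sup>2 *\<^sub>R S"
    by (simp add: transpose_scalar matrix_scalar_ac power2_eq_square flip: scalar_matrix_assoc)
  ultimately show ?thesis
    using distr_gauss_measure_affine_matrix[of ?C S m t] pos_def_mat_invertible[OF assms(1)] by simp
qed

lemma gauss_density_scaleR:
  fixes S :: "real^'n^'n"
  assumes "invertible S" "a > 0"
  shows "gauss_density m (a *\<^sub>R S) x
    = exp (- ((x - m) \<bullet> (matrix_inv S *v (x - m))) / (2 * a))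
        / sqrt ((2 * pi * a) ^ CARD('n) * det S)"
  using assms
  by (simp add: gauss_density_def matrix_inv_scaleR det_scaleR power_mult_distrib mult_ac
      flip: scaleR_matrix_vector_assoc)

lemma gauss_density_mult:
  fixes S :: "real^'n^'n"
  assumes S: "pos_def_mat S" and a: "a > 0" and b: "b > 0"
  shows "gauss_density m (a *\<^sub>R S) (x - y) * gauss_density k (b *\<^sub>R S) y
    = gauss_density (m + k) ((a + b) *\<^sub>R S) x
      * gauss_density (k + (b / (a + b)) *\<^sub>R (x - m - k)) ((a * b / (a + b)) *\<^sub>R S) y"
proof -
  let ?c = "\<lambda>a. sqrt ((2 * pi * a) ^ CARD('n) * det S)" and ?Q = "\<lambda>v. v \<bullet> (matrix_inv S *v v)"
  define u v where "u = x - m - k" and "v = y - k"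
  define w where "w = v - (b / (a + b)) *\<^sub>R u"
  have ab: "a + b > 0" "a * b / (a + b) > 0" using a b by simp_all
  note density = gauss_density_scaleR[OF pos_def_mat_invertible[OF S]]
  have shift: "x - y - m = u - v" "y - k = v" "x - (m + k) = u"
      "y - (k + (b / (a + b)) *\<^sub>R (x - m - k)) = w"
    by (simp_all add: u_def v_def w_def)
  have "?Q (u - v) / (2 * a) + ?Q v / (2 * b)
      = ?Q u / (2 * (a + b)) + ?Q w / (2 * (a * b / (a + b)))"
    unfolding w_def by (rule inner_matrix_complete_square[OF pos_def_mat_transpose_inv[OF S] a b])
  then have exponent: "exp (- ?Q (u - v) / (2 * a)) * exp (- ?Q v / (2 * b))
      = exp (- ?Q u / (2 * (a + b))) * exp (- ?Q w / (2 * (a * b / (a + b))))"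
    by (simp only: minus_divide_left[symmetric] flip: exp_add) simp
  have "(2 * pi * a) * (2 * pi * b) = (2 * pi * (a + b)) * (2 * pi * (a * b / (a + b)))"
    using ab(1) by (simp add: field_simps)
  then have "(2 * pi * a) ^ CARD('n) * (2 * pi * b) ^ CARD('n)
      = (2 * pi * (a + b)) ^ CARD('n) * (2 * pi * (a * b / (a + b))) ^ CARD('n)"
    by (metis power_mult_distrib)
  from arg_cong[OF this, of "\<lambda>t. t * (det S * det S)"]
  have "((2 * pi * a) ^ CARD('n) * det S) * ((2 * pi * b) ^ CARD('n) * det S)
      = ((2 * pi * (a + b)) ^ CARD('n) * det S) * ((2 * pi * (a * b / (a + b))) ^ CARD('n) * det S)"
    by (simp only: mult_ac)
  then have normalization: "?c a * ?c b = ?c (a + b) * ?c (a * b / (a + b))"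
    by (simp only: flip: real_sqrt_mult)
  show ?thesis
    unfolding density[OF a] density[OF b] density[OF ab(1)] density[OF ab(2)] shift
      times_divide_times_eq exponent normalization ..
qed

lemma convolution_gauss_measure:
  fixes S :: "real^'n^'n"
  assumes S: "pos_def_mat S" and a: "a > 0" and b: "b > 0"
  shows "(gauss_measure m (a *\<^sub>R S) \<star> gauss_measure k (b *\<^sub>R S))
      = gauss_measure (m + k) ((a + b) *\<^sub>R S)"
proof -
  note prob = prob_space_gauss_measure[OF pos_def_mat_scaleR[OF S]]
  have nonneg: "0 \<le> gauss_density m (c *\<^sub>R S) x" if "c > 0" for m c x
    using gauss_density_pos[OF pos_def_mat_scaleR[OF S that]] by (rule less_imp_le)
  have total: "(\<integral>\<^sup>+y. gauss_density m (c *\<^sub>R S) y \<partial>lborel) = 1" if "c > 0" for m c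
    using prob_space.emeasure_space_1[OF prob[OF that, of m]]
    by (simp add: gauss_measure_def emeasure_density)
  have "(\<integral>\<^sup>+y. ennreal (gauss_density m (a *\<^sub>R S) (x - y)) * gauss_density k (b *\<^sub>R S) y \<partial>lborel)
      = gauss_density (m + k) ((a + b) *\<^sub>R S) x" for x
  proof -
    have "(\<integral>\<^sup>+y. ennreal (gauss_density m (a *\<^sub>R S) (x - y)) * gauss_density k (b *\<^sub>R S) y \<partial>lborel)
        = (\<integral>\<^sup>+y. ennreal (gauss_density (m + k) ((a + b) *\<^sub>R S) x)
          * gauss_density (k + (b / (a + b)) *\<^sub>R (x - m - k)) ((a * b / (a + b)) *\<^sub>R S) y \<partial>lborel)"
      using a b by (simp add: nonneg gauss_density_mult[OF S a b] flip: ennreal_mult)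
    also have "\<dots> = gauss_density (m + k) ((a + b) *\<^sub>R S) x"
      using a b by (simp add: nn_integral_cmult total)
    finally show ?thesis .
  qed
  moreover have "finite_measure (density lborel (\<lambda>x. ennreal (gauss_density m (c *\<^sub>R S) x)))"
    if "c > 0" for m c
    using prob[OF that, of m] by (simp add: gauss_measure_def prob_space_def)
  ultimately show ?thesis
    using a b by (simp add: gauss_measure_def convolution_density_lborel)
qed

lemma distr_sum_gauss_measure:
  fixes S :: "real^'n^'n"
  assumes S: "pos_def_mat S" and a: "\<And>i. a i > 0" and I: "finite I" "I \<noteq> {}"
  shows "distr (PiM I (\<lambda>i. gauss_measure (m i) (a i *\<^sub>R S))) borel (\<lambda>x. \<Sum>i\<in>I. x i)
    = gauss_measure (\<Sum>i\<in>I. m i) ((\<Sum>i\<in>I. a i) *\<^sub>R S)"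
proof -
  let ?M = "\<lambda>i. gauss_measure (m i) (a i *\<^sub>R S)"
  have prob: "prob_space (?M i)" for i
    by (intro prob_space_gauss_measure pos_def_mat_scaleR S a)
  interpret product_sigma_finite ?M
    using prob by (rule product_sigma_finite_prob_space)
  from I show ?thesis
  proof (induction rule: finite_ne_induct)
    case (singleton i)
    show ?case
      using distr_singleton[of i] distr_cong[of "PiM {i} ?M" _ borel "?M i"] by simp
  next
    case (insert i I)
    have "distr (PiM (insert i I) ?M) borel (\<lambda>x. \<Sum>j\<in>insert i I. x j)
        = (?M i \<star> distr (PiM I ?M) borel (\<lambda>x. \<Sum>j\<in>I. x j))"
      using insert.hyps prob by (intro distr_sum_PiM_insert) auto
    also have "\<dots> = gauss_measure (m i + (\<Sum>j\<in>I. m j)) ((a i + (\<Sum>j\<in>I. a j)) *\<^sub>R S)"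
      unfolding insert.IH using a insert.hyps by (intro convolution_gauss_measure S sum_pos) auto
    finally show ?case using insert.hyps by simp
  qed
qed

lemma distr_mean_gauss_measure:
  fixes S :: "real^'n^'n"
  assumes S: "pos_def_mat S" and I: "finite I" "I \<noteq> {}"
  shows "distr (PiM I (\<lambda>_. gauss_measure mu S)) borel (\<lambda>x. (1 / card I) *\<^sub>R (\<Sum>i\<in>I. x i))
    = gauss_measure mu ((1 / card I) *\<^sub>R S)"
proof -
  have card: "real (card I) > 0" using I by (simp add: card_gt_0_iff)
  have "distr (PiM I (\<lambda>_. gauss_measure mu S)) borel (\<lambda>x. (1 / card I) *\<^sub>R (\<Sum>i\<in>I. x i))
      = distr (distr (PiM I (\<lambda>_. gauss_measure mu S)) borel (\<lambda>x. \<Sum>i\<in>I. x i)) borel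
          (\<lambda>s. 0 + (1 / card I) *\<^sub>R s)"
    by (subst distr_distr) (auto simp: comp_def)
  also have "distr (PiM I (\<lambda>_. gauss_measure mu S)) borel (\<lambda>x. \<Sum>i\<in>I. x i)
      = gauss_measure (real (card I) *\<^sub>R mu) (real (card I) *\<^sub>R S)"
    using distr_sum_gauss_measure[OF S, of "\<lambda>_. 1" I "\<lambda>_. mu"] I
    by (simp add: sum_constant_scaleR del: sum_constant)
  also have "distr \<dots> borel (\<lambda>s. 0 + (1 / card I) *\<^sub>R s) = gauss_measure mu ((1 / card I) *\<^sub>R S)"
    using card
    by (subst distr_gauss_measure_affine[OF pos_def_mat_scaleR[OF S]]) (auto simp: power2_eq_square)
  finally show ?thesis .
qed

lemma distr_mean_fun_upd_gauss_measure:
  fixes S :: "real^'n^'n"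
  assumes S: "pos_def_mat S" and I: "card I \<ge> 2" and J: "J \<in> I"
  shows "distr (PiM I (\<lambda>_. gauss_measure mu S)) borel (\<lambda>x. (1 / card I) *\<^sub>R (\<Sum>i\<in>I. (x(J := z)) i))
    = gauss_measure ((1 / card I) *\<^sub>R (z + (real (card I) - 1) *\<^sub>R mu))
        (((real (card I) - 1) / (real (card I))\<^sup>2) *\<^sub>R S)"
proof -
  let ?P = "\<lambda>I. PiM I (\<lambda>_. gauss_measure mu S)" and ?K = "I - {J}"
  have "finite I" using I card.infinite by fastforce
  then have card: "real (card ?K) = real (card I) - 1" "card ?K > 0"
    using I J by (simp_all add: of_nat_diff)
  have K: "finite ?K" "?K \<noteq> {}"
    using card(2) unfolding card_gt_0_iff by simp_all
  have sum: "(\<Sum>i\<in>I. (x(J := z)) i) = z + (\<Sum>i\<in>?K. (\<lambda>i\<in>?K. x i) i)" for x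
    using J \<open>finite I\<close> by (simp add: sum.remove)
  have "distr (?P I) borel (\<lambda>x. (1 / card I) *\<^sub>R (\<Sum>i\<in>I. (x(J := z)) i))
      = distr (distr (distr (?P I) (?P ?K) (\<lambda>x. \<lambda>i\<in>?K. x i)) borel (\<lambda>x. \<Sum>i\<in>?K. x i)) borel
          (\<lambda>s. (1 / card I) *\<^sub>R z + (1 / card I) *\<^sub>R s)"
    unfolding sum
    by (subst distr_distr, measurable, subst distr_distr) (auto simp: comp_def scaleR_add_right)
  also have "distr (?P I) (?P ?K) (\<lambda>x. \<lambda>i\<in>?K. x i) = ?P ?K"
    using distr_PiM_reindex[of I "\<lambda>_. gauss_measure mu S" "\<lambda>i. i" ?K] prob_space_gauss_measure[OF S]
    by auto
  also have "distr (?P ?K) borel (\<lambda>x. \<Sum>i\<in>?K. x i)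
      = gauss_measure ((real (card I) - 1) *\<^sub>R mu) ((real (card I) - 1) *\<^sub>R S)"
    using distr_sum_gauss_measure[OF S, of "\<lambda>_. 1" ?K "\<lambda>_. mu"] K card
    by (simp add: sum_constant_scaleR del: sum_constant)
  also have "distr \<dots> borel (\<lambda>s. (1 / card I) *\<^sub>R z + (1 / card I) *\<^sub>R s)
      = gauss_measure ((1 / card I) *\<^sub>R (z + (real (card I) - 1) *\<^sub>R mu))
          (((real (card I) - 1) / (real (card I))\<^sup>2) *\<^sub>R S)"
    using I by (subst distr_gauss_measure_affine[OF pos_def_mat_scaleR[OF S]])
      (auto simp: power_one_over scaleR_add_right)
  finally show ?thesis .
qed

lemma AE_PiM_gauss_measure_iff:
  fixes S :: "real^'d^'d"
  assumes "finite I" and S: "pos_def_mat S"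
  shows "(AE w in PiM I (\<lambda>_. gauss_measure mu S). P w) \<longleftrightarrow> (AE w in PiM I (\<lambda>_. lborel). P w)"
proof -
  let ?f = "\<lambda>_ x. ennreal (gauss_density mu S x)"
  have "product_sigma_finite (\<lambda>i. density lborel (?f i))"
    using prob_space_gauss_measure[OF S, of mu]
    by (intro product_sigma_finite_prob_space) (simp add: gauss_measure_def)
  moreover have "product_sigma_finite (\<lambda>_. lborel :: (real^'d) measure)" ..
  ultimately have density: "PiM I (\<lambda>_. gauss_measure mu S)
      = density (PiM I (\<lambda>_. lborel)) (\<lambda>w. \<Prod>i\<in>I. ?f i (w i))"
    unfolding gauss_measure_def using \<open>finite I\<close> by (intro PiM_density) auto
  have "(\<Prod>i\<in>I. ?f i (w i)) > 0" for w
    using gauss_density_pos[OF S] by (simp add: prod_ennreal less_imp_le prod_pos)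
  then show ?thesis
    unfolding density
    by (subst AE_density)
      (auto intro!: borel_measurable_prod_ennreal
        measurable_compose[OF measurable_component_singleton])
qed

section \<open>Running means\<close>

definition batch_means :: "nat \<Rightarrow> nat \<Rightarrow> (nat \<times> nat \<Rightarrow> 'a::real_vector) \<Rightarrow> nat \<Rightarrow> 'a" where
  "batch_means T n X = (\<lambda>t\<in>{1..T}. (1 / real n) *\<^sub>R (\<Sum>k=1..n. X (t, k)))"

definition running_means :: "nat \<Rightarrow> (nat \<Rightarrow> 'a::real_vector) \<Rightarrow> nat \<Rightarrow> 'a" where
  "running_means T w = (\<lambda>t\<in>{1..T}. (1 / real t) *\<^sub>R (\<Sum>j=1..t. w j))"

definition unaverage :: "nat \<Rightarrow> (nat \<Rightarrow> real^'d) \<Rightarrow> nat \<Rightarrow> real^'d" where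
  "unaverage T y = (\<lambda>t\<in>{1..T}. real t *\<^sub>R mu_hat y t - (real t - 1) *\<^sub>R mu_hat y (t - 1))"

lemma N_tau_eq_unaverage: "tau \<in> {1..T} \<Longrightarrow> N_tau tau mu y = unaverage T y tau - mu"
  by (simp add: N_tau_def unaverage_def)

lemma cum_means_eq_running_means: "(cum_means T n :: _ \<Rightarrow> nat \<Rightarrow> real^'d)
    = running_means T \<circ> batch_means T n"
  unfolding cum_means_def running_means_def comp_def
proof (rule ext, rule restrict_ext)
  fix X :: "nat \<times> nat \<Rightarrow> real^'d" and t assume "t \<in> {1..T}"
  then have "(\<Sum>j=1..t. batch_means T n X j) = (1 / real n) *\<^sub>R (\<Sum>j=1..t. \<Sum>k=1..n. X (j, k))"
    unfolding scaleR_sum_right batch_means_def by (intro sum.cong) auto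
  then show "(1 / (real n * real t)) *\<^sub>R (\<Sum>j=1..t. \<Sum>k=1..n. X (j, k))
      = (1 / real t) *\<^sub>R (\<Sum>j=1..t. batch_means T n X j)"
    by (simp add: mult.commute)
qed

lemma running_means_unaverage:
  assumes "y \<in> extensional {1..T}"
  shows "running_means T (unaverage T y) = y"
proof
  fix t
  have "(\<Sum>j=1..t. unaverage T y j) = real t *\<^sub>R mu_hat y t" if "t \<le> T"
    using that by (induction t) (auto simp: unaverage_def)
  then show "running_means T (unaverage T y) t = y t"
    using assms by (auto simp: running_means_def mu_hat_def extensional_def)
qed

lemma unaverage_running_means:
  assumes "t \<in> {1..T}"
  shows "unaverage T (running_means T w) t = w t"
proof -
  have sum: "real s *\<^sub>R mu_hat (running_means T w) s = (\<Sum>j=1..s. w j)" if "s \<le> T" for s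
    using that by (auto simp: mu_hat_def running_means_def)
  obtain s where "t = Suc s" using assms by (cases t) auto
  then show ?thesis
    using assms sum[of t] sum[of s] by (simp add: unaverage_def)
qed

lemma measurable_running_means [measurable]: "running_means T \<in> obs_space T \<rightarrow>\<^sub>M obs_space T"
  unfolding running_means_def obs_space_def
proof (rule measurable_restrict)
  fix t assume "t \<in> {1..T}"
  then have [measurable]: "(\<lambda>w. w j) \<in> PiM {1..T} (\<lambda>_. lborel) \<rightarrow>\<^sub>M (borel :: (real^'d) measure)"
    if "j \<in> {1..t}" for j
    using that measurable_component_singleton[of j "{1..T}" "\<lambda>_. lborel :: (real^'d) measure"]
    by auto
  show "(\<lambda>w. (1 / real t) *\<^sub>R (\<Sum>j=1..t. w j)) \<in> PiM {1..T} (\<lambda>_. lborel)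
      \<rightarrow>\<^sub>M (lborel :: (real^'d) measure)"
    by (simp del: One_nat_def)
qed

lemma measurable_unaverage [measurable]: "unaverage T \<in> obs_space T \<rightarrow>\<^sub>M obs_space T"
  unfolding unaverage_def obs_space_def
proof (rule measurable_restrict)
  fix t assume t: "t \<in> {1..T}"
  have mu_hat: "(\<lambda>y. mu_hat y s) \<in> PiM {1..T} (\<lambda>_. lborel) \<rightarrow>\<^sub>M borel" if "s \<le> T" for s
    using that measurable_component_singleton[of s "{1..T}" "\<lambda>_. lborel"]
    by (cases "s = 0") (auto simp: mu_hat_def)
  have "t \<le> T" "t - 1 \<le> T" using t by auto
  note [measurable] = this[THEN mu_hat]
  show "(\<lambda>y. real t *\<^sub>R mu_hat y t - (real t - 1) *\<^sub>R mu_hat y (t - 1)) \<in> PiM {1..T} (\<lambda>_. lborel)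
      \<rightarrow>\<^sub>M lborel"
    by measurable
qed

lemma measurable_obs_space_component: "t \<in> {1..T} \<Longrightarrow> (\<lambda>w. w t) \<in> obs_space T \<rightarrow>\<^sub>M borel"
  unfolding obs_space_def using measurable_component_singleton[of t "{1..T}" "\<lambda>_. lborel"] by simp

lemma measurable_N_tau [measurable]:
  assumes "tau \<in> {1..T}"
  shows "N_tau tau mu \<in> obs_space T \<rightarrow>\<^sub>M borel"
proof -
  note [measurable] =
    measurable_compose[OF measurable_unaverage measurable_obs_space_component[OF assms]]
  have "N_tau tau mu = (\<lambda>y. unaverage T y tau - mu)"
    using assms by (simp add: N_tau_eq_unaverage fun_eq_iff)
  then show ?thesis by simp
qed

lemma unaverage_fun_upd_Suc:
  "unaverage (Suc T) (x(Suc T := y))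
      = (unaverage T x)(Suc T := - (real T *\<^sub>R mu_hat x T) + real (Suc T) *\<^sub>R y)"
proof
  fix t
  consider "t = Suc T" | "t \<in> {1..T}" | "t \<notin> {1..Suc T}" by fastforce
  then show "unaverage (Suc T) (x(Suc T := y)) t
      = ((unaverage T x)(Suc T := - (real T *\<^sub>R mu_hat x T) + real (Suc T) *\<^sub>R y)) t"
    by cases (auto simp: unaverage_def mu_hat_def)
qed

lemma obs_space_Suc: "obs_space (Suc T) = PiM (insert (Suc T) {1..T}) (\<lambda>_. lborel)"
  unfolding obs_space_def by (rule arg_cong[where f="\<lambda>I. PiM I _"]) auto

lemma AE_obs_space_Suc_iff:
  fixes P :: "(nat \<Rightarrow> real^'d) \<Rightarrow> bool"
  assumes "Measurable.pred (obs_space (Suc T)) P"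
  shows "(AE w in obs_space (Suc T). P w)
      \<longleftrightarrow> (AE w in obs_space T. AE y in lborel. P (w(Suc T := y)))"
proof -
  interpret product_sigma_finite "\<lambda>_::nat. lborel :: (real^'d) measure" ..
  show ?thesis
    using assms unfolding obs_space_Suc unfolding obs_space_def by (intro AE_PiM_insert_iff) auto
qed

lemma AE_unaverage:
  assumes "Measurable.pred (obs_space T) P" and "AE w in obs_space T. P w"
  shows "AE y in obs_space T. P (unaverage T y)"
  using assms
proof (induction T arbitrary: P)
  case 0
  have "(AE y in obs_space 0. P (unaverage 0 y)) \<longleftrightarrow> (AE y in obs_space 0. P y)"
    by (rule AE_cong) (auto simp: unaverage_def obs_space_def space_PiM intro!: arg_cong[where f=P])
  with 0(2) show ?case by blast
next
  case (Suc T)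
  interpret sigma_finite_measure "lborel :: (real^'a) measure" ..
  have P[measurable]: "Measurable.pred (PiM (insert (Suc T) {1..T}) (\<lambda>_. lborel)) P"
    using Suc.prems(1) unfolding obs_space_Suc .
  have pred_upd: "Measurable.pred borel (\<lambda>y. P (w(Suc T := y)))" if "w \<in> space (obs_space T)" for w
    using measurable_compose[OF measurable_component_update[OF that[unfolded obs_space_def]] P]
    by simp
  have "AE w in obs_space T. AE y in lborel. P (w(Suc T := y))"
    using Suc.prems AE_obs_space_Suc_iff by blast
  then have "AE x in obs_space T. AE y in lborel. P ((unaverage T x)(Suc T := y))"
    by (intro Suc.IH) (unfold obs_space_def, measurable)
  then have "AE x in obs_space T. AE y in lborel. P (unaverage (Suc T) (x(Suc T := y)))"
    using AE_space
  proof eventually_elim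
    case (elim x)
    then show ?case
      unfolding unaverage_fun_upd_Suc
      by (intro AE_lborel_affine[where P="\<lambda>y. P ((unaverage T x)(Suc T := y))"] pred_upd
          measurable_space[OF measurable_unaverage]) auto
  qed
  then show ?case
    using AE_obs_space_Suc_iff[OF measurable_compose[OF measurable_unaverage Suc.prems(1)]] by blast
qed

section \<open>The likelihood ratio\<close>

lemma distributed_AE_finite:
  assumes "prob_space M" and f: "distributed M N X f"
  shows "AE y in N. f y \<noteq> \<infinity>"
proof (rule nn_integral_PInf_AE)
  show [measurable]: "f \<in> borel_measurable N" using f by (rule distributed_borel_measurable)
  interpret prob_space "distr M N X"
    using assms distributed_measurable by (intro prob_space.prob_space_distr)
  have "(\<integral>\<^sup>+y. f y \<partial>N) = emeasure (density N f) (space N)"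
    by (subst emeasure_density) (auto intro!: nn_integral_cong)
  also have "\<dots> = 1"
    using emeasure_space_1 by (simp add: distributed_distr_eq_density[OF f])
  finally show "(\<integral>\<^sup>+y. f y \<partial>N) \<noteq> \<infinity>" by simp
qed

lemma distributed_ln_density_ratio:
  assumes N: "sigma_finite_measure N" and M: "prob_space M"
    and f: "distributed M N X f" and g: "distributed M' N X' g"
    and l[measurable]: "l \<in> borel_measurable N"
    and ratio: "distr M' N X' = density (distr M N X) (\<lambda>y. ennreal (exp (l y)))"
    and nonzero: "AE y in N. f y \<noteq> 0"
  shows "AE y in N. ln (enn2real (g y) / enn2real (f y)) = l y"
proof -
  have [measurable]: "f \<in> borel_measurable N" "g \<in> borel_measurable N"
    using f g by (auto intro: distributed_borel_measurable)
  have "density N g = density N (\<lambda>y. f y * ennreal (exp (l y)))"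
    using ratio unfolding distributed_distr_eq_density[OF f] distributed_distr_eq_density[OF g]
    by (simp add: density_density_eq)
  then have "AE y in N. g y = f y * ennreal (exp (l y))"
    by (intro sigma_finite_measure.density_unique[OF N]) auto
  with nonzero distributed_AE_finite[OF M f] show ?thesis
  proof eventually_elim
    case (elim y)
    then have "enn2real (f y) \<noteq> 0" by (auto simp: enn2real_eq_0_iff)
    with elim show ?case by (simp add: enn2real_mult)
  qed
qed

definition log_LR :: "nat \<Rightarrow> real^'d \<Rightarrow> real^'d^'d \<Rightarrow> real^'d \<Rightarrow> real^'d \<Rightarrow> real" where
  "log_LR n mu S z N =
    - (real CARD('d) / 2) * ln ((real n - 1) / real n)
    - real n / (2 * (real n - 1)) * (N \<bullet> (matrix_inv S *v N))
    + real n / (real n - 1) * (N \<bullet> (matrix_inv S *v (z - mu)))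
    - ((z - mu) \<bullet> (matrix_inv S *v (z - mu))) / (2 * (real n - 1))"

lemma borel_measurable_log_LR [measurable (raw)]:
  assumes [measurable]: "f \<in> borel_measurable M"
  shows "(\<lambda>x. log_LR n mu S z (f x)) \<in> borel_measurable M"
  unfolding log_LR_def by measurable

lemma exp_ln_eq_inverse_sqrt_power:
  assumes "r > 0"
  shows "exp (- (real k / 2) * ln r) = 1 / sqrt (r ^ k)"
proof -
  have "ln (sqrt (r ^ k)) = real k / 2 * ln r"
    using assms by (simp add: ln_sqrt ln_realpow)
  moreover have "exp (ln (sqrt (r ^ k))) = sqrt (r ^ k)"
    using assms by simp
  ultimately have "exp (real k / 2 * ln r) = sqrt (r ^ k)"
    by (simp only:)
  then show ?thesis
    by (simp only: mult_minus_left exp_minus inverse_eq_divide)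
qed

lemma gauss_density_replaced_mean:
  fixes S :: "real^'d^'d"
  assumes n: "n \<ge> 2" and S: "pos_def_mat S"
  shows "gauss_density ((1 / real n) *\<^sub>R (z + (real n - 1) *\<^sub>R mu))
      (((real n - 1) / (real n)\<^sup>2) *\<^sub>R S) w
    = gauss_density mu ((1 / real n) *\<^sub>R S) w * exp (log_LR n mu S z (w - mu))"
proof -
  define N where "N = real n"
  have N: "N > 1" "N > 0" using n by (simp_all add: N_def)
  then have pos: "(N - 1) / N\<^sup>2 > 0" "1 / N > 0" "(N - 1) / N > 0" by simp_all
  let ?Q = "\<lambda>v. v \<bullet> (matrix_inv S *v v)" and ?c = "\<lambda>a. sqrt ((2 * pi * a) ^ CARD('d) * det S)"
  define u v where "u = w - mu" and "v = z - mu"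
  define q where "q = - N / (2 * (N - 1)) * ?Q u
      + N / (N - 1) * (u \<bullet> (matrix_inv S *v v)) - ?Q v / (2 * (N - 1))"
  note density = gauss_density_scaleR[OF pos_def_mat_invertible[OF S]]
  have shift: "w - (1 / N) *\<^sub>R (z + (N - 1) *\<^sub>R mu) = u - (1 / N) *\<^sub>R v"
    using N by (simp add: u_def v_def algebra_simps diff_divide_distrib)
  obtain M where M: "N = M + 1" "M > 0"
    using N by (metis add.commute diff_add_cancel diff_gt_0_iff_gt)
  have "- ?Q (u - (1 / N) *\<^sub>R v) / (2 * ((N - 1) / N\<^sup>2)) = - ?Q u / (2 * (1 / N)) + q"
    unfolding q_def inner_matrix_diff_scaleR[OF pos_def_mat_transpose_inv[OF S]] M(1)
    using M(2) by (simp add: divide_simps power2_eq_square) (simp add: algebra_simps)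
  then have exponent: "exp (- ?Q (u - (1 / N) *\<^sub>R v) / (2 * ((N - 1) / N\<^sup>2)))
      = exp (- ?Q u / (2 * (1 / N))) * exp q"
    by (simp only: exp_add)
  have "(2 * pi * ((N - 1) / N\<^sup>2)) ^ CARD('d) * det S
      = (2 * pi * (1 / N)) ^ CARD('d) * det S * ((N - 1) / N) ^ CARD('d)"
    by (simp add: power2_eq_square flip: power_mult_distrib)
  then have normalization: "?c ((N - 1) / N\<^sup>2)
      = ?c (1 / N) / exp (- (real CARD('d) / 2) * ln ((N - 1) / N))"
    unfolding exp_ln_eq_inverse_sqrt_power[OF pos(3)] by (simp only: real_sqrt_mult) simp
  have "log_LR n mu S z (w - mu) = - (real CARD('d) / 2) * ln ((N - 1) / N) + q"
    by (simp add: log_LR_def q_def u_def v_def N_def)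
  then have "exp (log_LR n mu S z (w - mu))
      = exp (- (real CARD('d) / 2) * ln ((N - 1) / N)) * exp q"
    by (simp only: exp_add)
  then show ?thesis
    unfolding N_def[symmetric] density[OF pos(1)] density[OF pos(2)] shift exponent normalization
    by (simp add: u_def)
qed

lemma gauss_measure_replaced_mean:
  fixes S :: "real^'d^'d"
  assumes n: "n \<ge> 2" and S: "pos_def_mat S"
  shows "gauss_measure ((1 / real n) *\<^sub>R (z + (real n - 1) *\<^sub>R mu)) (((real n - 1) / (real n)\<^sup>2) *\<^sub>R S)
    = density (gauss_measure mu ((1 / real n) *\<^sub>R S)) (\<lambda>w. ennreal (exp (log_LR n mu S z (w - mu))))"
  unfolding gauss_measure_def gauss_density_replaced_mean[OF n S]
  by (subst density_density_eq) (auto simp: ennreal_mult'')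

lemma prob_space_H0_data: "pos_def_mat S \<Longrightarrow> prob_space (H0_data T n mu S)"
  unfolding H0_data_def by (intro prob_space_PiM prob_space_gauss_measure)

lemma measurable_batch_means_H0 [measurable]: "batch_means T n \<in> H0_data T n mu S \<rightarrow>\<^sub>M obs_space T"
  unfolding H0_data_def obs_space_def batch_means_def by measurable

lemma measurable_cum_means_H0 [measurable]: "cum_means T n \<in> H0_data T n mu S \<rightarrow>\<^sub>M obs_space T"
  unfolding cum_means_eq_running_means by measurable

lemma measurable_fun_upd_H0:
  assumes "p \<in> {1..T} \<times> {1..n}"
  shows "(\<lambda>X. X(p := z)) \<in> H0_data T n mu S \<rightarrow>\<^sub>M H0_data T n mu S"
  using assms unfolding H0_data_def by (intro measurable_fun_upd[where J="{1..T} \<times> {1..n}"]) auto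

lemma distr_rows_H0:
  fixes S :: "real^'d^'d"
  assumes S: "pos_def_mat S"
    and g: "\<And>t. g t \<in> borel_measurable (PiM {1..n} (\<lambda>_. gauss_measure mu S))"
  shows "distr (H0_data T n mu S) (obs_space T) (\<lambda>X. \<lambda>t\<in>{1..T}. g t (\<lambda>k\<in>{1..n}. X (t, k)))
    = PiM {1..T} (\<lambda>t. distr (PiM {1..n} (\<lambda>_. gauss_measure mu S)) borel (g t))"
proof -
  have "distr (H0_data T n mu S) (obs_space T) (\<lambda>X. \<lambda>t\<in>{1..T}. g t (\<lambda>k\<in>{1..n}. X (t, k)))
      = PiM {1..T} (\<lambda>t. distr (PiM {1..n} (\<lambda>_. gauss_measure mu S)) lborel (g t))"
    unfolding H0_data_def obs_space_def
    using g by (intro distr_PiM_rows prob_space_gauss_measure S) auto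
  then show ?thesis by (simp cong: distr_cong)
qed

lemma distr_batch_means_H0:
  fixes S :: "real^'d^'d"
  assumes n: "n \<ge> 1" and S: "pos_def_mat S"
  shows "distr (H0_data T n mu S) (obs_space T) (batch_means T n)
      = PiM {1..T} (\<lambda>_. gauss_measure mu ((1 / real n) *\<^sub>R S))"
proof -
  let ?row = "PiM {1..n} (\<lambda>_. gauss_measure mu S)" and ?mean = "\<lambda>r. (1 / real n) *\<^sub>R (\<Sum>k=1..n. r k)"
  have "distr (H0_data T n mu S) (obs_space T) (batch_means T n)
      = distr (H0_data T n mu S) (obs_space T) (\<lambda>X. \<lambda>t\<in>{1..T}. ?mean (\<lambda>k\<in>{1..n}. X (t, k)))"
    by (rule arg_cong[where f="distr _ _"]) (simp add: batch_means_def fun_eq_iff)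
  also have "\<dots> = PiM {1..T} (\<lambda>_. distr ?row borel ?mean)"
    by (rule distr_rows_H0[OF S]) measurable
  also have "distr ?row borel ?mean = gauss_measure mu ((1 / real n) *\<^sub>R S)"
    using distr_mean_gauss_measure[OF S, of "{1..n}" mu] n by simp
  finally show ?thesis .
qed

lemma distr_batch_means_fun_upd_H0:
  fixes S :: "real^'d^'d"
  assumes n: "n \<ge> 2" and S: "pos_def_mat S" and tau: "tau \<in> {1..T}" and J: "J \<in> {1..n}"
  shows "distr (H0_data T n mu S) (obs_space T) (\<lambda>X. batch_means T n (X((tau, J) := z)))
    = density (PiM {1..T} (\<lambda>_. gauss_measure mu ((1 / real n) *\<^sub>R S)))
        (\<lambda>w. ennreal (exp (log_LR n mu S z (w tau - mu))))"
proof -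
  let ?row = "PiM {1..n} (\<lambda>_. gauss_measure mu S)" and ?N = "gauss_measure mu ((1 / real n) *\<^sub>R S)"
    and ?R = "\<lambda>w. ennreal (exp (log_LR n mu S z (w - mu)))"
  define mean :: "nat \<Rightarrow> (nat \<Rightarrow> real^'d) \<Rightarrow> real^'d" where
    "mean = (\<lambda>t r. (1 / real n) *\<^sub>R (\<Sum>k=1..n. if t = tau \<and> k = J then z else r k))"
  have "batch_means T n (X((tau, J) := z)) = (\<lambda>t\<in>{1..T}. mean t (\<lambda>k\<in>{1..n}. X (t, k)))" for X
    unfolding batch_means_def mean_def
    by (intro restrict_ext arg_cong[where f="\<lambda>x. _ *\<^sub>R x"] sum.cong) auto
  moreover have "mean t \<in> borel_measurable ?row" for t
  proof -
    have [measurable]: "(\<lambda>r. r k) \<in> borel_measurable ?row" if "k \<in> {1..n}" for k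
      using measurable_component_singleton[OF that, of "\<lambda>_. gauss_measure mu S"]
        measurable_cong_sets[OF refl sets_gauss_measure] by blast
    show ?thesis unfolding mean_def by measurable
  qed
  moreover have "distr ?row borel (mean t) = ((\<lambda>_. ?N)(tau := density ?N ?R)) t" for t
    using distr_mean_gauss_measure[OF S, of "{1..n}" mu]
      distr_mean_fun_upd_gauss_measure[OF S, of "{1..n}" J mu z]
      gauss_measure_replaced_mean[OF n S, of z mu] n J
    by (simp add: mean_def)
  ultimately have "distr (H0_data T n mu S) (obs_space T) (\<lambda>X. batch_means T n (X((tau, J) := z)))
      = PiM {1..T} ((\<lambda>_. ?N)(tau := density ?N ?R))"
    using distr_rows_H0[OF S, of mean n mu T] by (simp add: fun_upd_def)
  also have "\<dots> = density (PiM {1..T} (\<lambda>_. ?N)) (\<lambda>w. ?R (w tau))"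
  proof (rule PiM_density_component)
    have "prob_space ?N" "prob_space (density ?N ?R)"
      unfolding gauss_measure_replaced_mean[OF n S, symmetric]
      using n by (auto intro!: prob_space_gauss_measure pos_def_mat_scaleR S)
    then show "product_sigma_finite (\<lambda>_::nat. ?N)" "sigma_finite_measure (density ?N ?R)"
      by (auto intro: product_sigma_finite_prob_space prob_space_imp_sigma_finite)
  qed (use tau in auto)
  finally show ?thesis .
qed

lemma distr_cum_means_fun_upd_H0:
  fixes S :: "real^'d^'d"
  assumes n: "n \<ge> 2" and S: "pos_def_mat S" and tau: "tau \<in> {1..T}" and J: "J \<in> {1..n}"
  shows "distr (H0_data T n mu S) (obs_space T) (\<lambda>X. cum_means T n (X((tau, J) := z)))
    = density (distr (H0_data T n mu S) (obs_space T) (cum_means T n))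
        (\<lambda>y. ennreal (exp (log_LR n mu S z (N_tau tau mu y))))"
proof -
  let ?R = "\<lambda>w. ennreal (exp (log_LR n mu S z (w tau - mu)))"
    and ?L = "\<lambda>y. ennreal (exp (log_LR n mu S z (N_tau tau mu y)))"
    and ?W = "distr (H0_data T n mu S) (obs_space T) (batch_means T n)"
  have [measurable]: "(\<lambda>X. batch_means T n (X((tau, J) := z))) \<in> H0_data T n mu S \<rightarrow>\<^sub>M obs_space T"
    using tau J
    by (intro measurable_compose[OF measurable_fun_upd_H0 measurable_batch_means_H0]) auto
  have "distr (H0_data T n mu S) (obs_space T) (\<lambda>X. cum_means T n (X((tau, J) := z)))
      = distr (distr (H0_data T n mu S) (obs_space T) (\<lambda>X. batch_means T n (X((tau, J) := z))))
          (obs_space T) (running_means T)"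
    by (simp add: distr_distr comp_def cum_means_eq_running_means)
  also have "\<dots> = distr (density ?W ?R) (obs_space T) (running_means T)"
    using n distr_batch_means_H0[of n S T mu] distr_batch_means_fun_upd_H0[OF assms] S by simp
  also have "\<dots> = distr (density ?W (\<lambda>w. ?L (running_means T w))) (obs_space T) (running_means T)"
    by (simp only: N_tau_eq_unaverage[OF tau] unaverage_running_means[OF tau])
  also have "\<dots> = density (distr ?W (obs_space T) (running_means T)) ?L"
    using tau by (intro density_distr[symmetric, of ?L]) simp_all
  also have "distr ?W (obs_space T) (running_means T)
      = distr (H0_data T n mu S) (obs_space T) (cum_means T n)"
    by (simp add: distr_distr cum_means_eq_running_means)
  finally show ?thesis .
qed

text \<open>The kernel in \<open>H1_data\<close> is defined for every natural number \<open>J\<close>. For \<open>J\<close> outside \<open>{1..n}\<close> the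
  update leaves the product space and is not measurable, hence the arbitrary \<open>f\<close>.\<close>
lemma distr_in_subprob_algebra:
  assumes "prob_space M"
  shows "distr M M f \<in> space (subprob_algebra M)"
proof -
  interpret prob_space M by fact
  have "emeasure (distr M M f) (space M) \<le> 1"
    unfolding distr_def emeasure_measure_of_conv by (auto intro: emeasure_le_1)
  then have "subprob_space (distr M M f)"
    using not_empty by (intro subprob_spaceI) auto
  then show ?thesis by (simp add: space_subprob_algebra)
qed

lemma distr_cum_means_H1:
  fixes S :: "real^'d^'d"
  assumes n: "n \<ge> 2" and S: "pos_def_mat S" and tau: "tau \<in> {1..T}"
  shows "distr (H1_data T n tau mu S z) (obs_space T) (cum_means T n)
    = density (distr (H0_data T n mu S) (obs_space T) (cum_means T n))
        (\<lambda>y. ennreal (exp (log_LR n mu S z (N_tau tau mu y))))" (is "_ = ?D")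
proof -
  let ?H0 = "H0_data T n mu S" and ?J = "measure_pmf (pmf_of_set {1..n})"
  let ?kernel = "\<lambda>J. distr ?H0 ?H0 (\<lambda>X. X((tau, J) := z))"
    and ?O = "obs_space T :: (nat \<Rightarrow> real^'d) measure"
  have kernel: "?kernel \<in> ?J \<rightarrow>\<^sub>M subprob_algebra ?H0"
    using distr_in_subprob_algebra[OF prob_space_H0_data[OF S]] by simp
  have kernel_cum_means: "(\<lambda>J. distr (?kernel J) ?O (cum_means T n)) \<in> ?J \<rightarrow>\<^sub>M subprob_algebra ?O"
    by (rule measurable_compose[OF kernel measurable_distr]) measurable
  have replaced: "distr (?kernel J) ?O (cum_means T n) = ?D" if "J \<in> {1..n}" for J
    using that tau measurable_fun_upd_H0[of "(tau, J)" T n z mu S]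
      distr_cum_means_fun_upd_H0[OF n S tau that, of mu z]
    by (simp add: distr_distr comp_def)
  have "distr (?kernel 1) ?O (cum_means T n) \<in> space (subprob_algebra ?O)"
    using measurable_space[OF kernel_cum_means] by simp
  then have mixture: "?D \<in> space (subprob_algebra ?O)"
    using replaced[of 1] n by simp
  have "distr (H1_data T n tau mu S z) ?O (cum_means T n)
      = ?J \<bind> (\<lambda>J. distr (?kernel J) ?O (cum_means T n))"
    unfolding H1_data_def by (rule distr_bind[OF kernel]) auto
  also have "\<dots> = ?J \<bind> (\<lambda>_. ?D)"
    using n replaced mixture
    by (intro bind_cong_AE[OF refl kernel_cum_means]) (auto simp: AE_measure_pmf_iff)
  also have "\<dots> = ?D"
    using mixture
    by (intro bind_const' measure_pmf.prob_space_axioms) (simp add: space_subprob_algebra)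
  finally show ?thesis .
qed

lemma density_cum_means_H0_nonzero:
  fixes S :: "real^'d^'d"
  assumes n: "n \<ge> 1" and S: "pos_def_mat S"
    and f0: "distributed (H0_data T n mu S) (obs_space T) (cum_means T n) f0"
  shows "AE y in obs_space T. f0 y \<noteq> 0"
proof -
  let ?H0 = "H0_data T n mu S" and ?N = "gauss_measure mu ((1 / real n) *\<^sub>R S)"
  have [measurable]: "f0 \<in> borel_measurable (obs_space T)"
    by (rule distributed_borel_measurable[OF f0])
  have "density (obs_space T) f0
      = distr (distr ?H0 (obs_space T) (batch_means T n)) (obs_space T) (running_means T)"
    unfolding distributed_distr_eq_density[OF f0, symmetric] cum_means_eq_running_means
    by (simp add: distr_distr)
  also have "\<dots> = distr (PiM {1..T} (\<lambda>_. ?N)) (obs_space T) (running_means T)"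
    by (simp only: distr_batch_means_H0[OF n S])
  finally have law: "density (obs_space T) f0
      = distr (PiM {1..T} (\<lambda>_. ?N)) (obs_space T) (running_means T)" .
  have "sets (PiM {1..T} (\<lambda>_. ?N)) = sets (obs_space T)"
    unfolding obs_space_def by (rule sets_PiM_cong) simp_all
  then have running_means: "running_means T \<in> PiM {1..T} (\<lambda>_. ?N) \<rightarrow>\<^sub>M obs_space T"
    using measurable_running_means measurable_cong_sets by blast
  have "AE y in density (obs_space T) f0. f0 y \<noteq> 0"
    by (subst AE_density) auto
  then have "AE w in PiM {1..T} (\<lambda>_. ?N). f0 (running_means T w) \<noteq> 0"
    unfolding law by (subst (asm) AE_distr_iff[OF running_means]) auto
  then have "AE w in obs_space T. f0 (running_means T w) \<noteq> 0"
    unfolding obs_space_def using n S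
    by (subst (asm) AE_PiM_gauss_measure_iff) (auto intro: pos_def_mat_scaleR)
  then have "AE y in obs_space T. f0 (running_means T (unaverage T y)) \<noteq> 0"
    by (rule AE_unaverage[rotated]) measurable
  then show ?thesis
    using AE_space
  proof eventually_elim
    case (elim y)
    then show ?case
      by (simp add: running_means_unaverage obs_space_def space_PiM PiE_def del: One_nat_def)
  qed
qed

theorem theorem3p1:
  fixes T n tau :: nat and mu z :: "real^'d" and S :: "real^'d^'d"
    and f0 f1 :: "(nat \<Rightarrow> real^'d) \<Rightarrow> ennreal"
  assumes "T \<ge> 1" and "n \<ge> 2" and "tau \<in> {1..T}" and "pos_def_mat S"
    and "distributed (H0_data T n mu S) (obs_space T) (cum_means T n) f0"
    and "distributed (H1_data T n tau mu S z) (obs_space T) (cum_means T n) f1"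
  shows "AE y in obs_space T.
           ln (enn2real (f1 y) / enn2real (f0 y)) =
             - (real CARD('d) / 2) * ln ((real n - 1) / real n)
             - real n / (2 * (real n - 1)) * (N_tau tau mu y \<bullet> (matrix_inv S *v N_tau tau mu y))
             + real n / (real n - 1) * (N_tau tau mu y \<bullet> (matrix_inv S *v (z - mu)))
             - ((z - mu) \<bullet> (matrix_inv S *v (z - mu))) / (2 * (real n - 1))"
  unfolding log_LR_def[symmetric]
proof (rule distributed_ln_density_ratio)
  interpret product_sigma_finite "\<lambda>_::nat. lborel :: (real^'d) measure" ..
  show "sigma_finite_measure (obs_space T :: (nat \<Rightarrow> real^'d) measure)"
    unfolding obs_space_def by (rule sigma_finite) simp
  show "prob_space (H0_data T n mu S)"
    by (rule prob_space_H0_data[OF assms(4)])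
  show "(\<lambda>y. log_LR n mu S z (N_tau tau mu y)) \<in> borel_measurable (obs_space T)"
    using assms(3) by measurable
  show "distr (H1_data T n tau mu S z) (obs_space T) (cum_means T n)
      = density (distr (H0_data T n mu S) (obs_space T) (cum_means T n))
          (\<lambda>y. ennreal (exp (log_LR n mu S z (N_tau tau mu y))))"
    by (rule distr_cum_means_H1[OF assms(2,4,3)])
  show "AE y in obs_space T. f0 y \<noteq> 0"
    using assms(2) by (intro density_cum_means_H0_nonzero[OF _ assms(4,5)]) simp
qed (rule assms)+

end
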